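(* Let $G=(V;E)$ be the random graph. Any minimal unary function $f\colon V\to V$ on $G$ is equivalent to exactly one of the following operations: (1) a constant operation; (2) $e_N$; (3) $e_E$; (4) $-$; (5) $\mathrm{sw}$.
   Context: Random graph: $G=(V;E)$ is the countably infinite (undirected, loopless) graph, unique up to isomorphism, such that for all finite disjoint $U,U'\subseteq V$ there is $v\in V\setminus(U\cup U')$ adjacent to all vertices in $U$ and to none in $U'$. $E$ is regarded as a symmetric binary relation, $N:=\{(x,y)\in V^2 : (x,y)\notin E,\ x\neq y\}$, and $\mathrm{Aut}(G)$ is the automorphism group of $G$. Generation: for $f\colon V^k\to V$ and $g\colon V^l\to V$, $f$ generates $g$ iff for every finite $S\subseteq V^l$ the restriction $g|_S$ equals the restriction to $S$ of an $l$-ary operation obtained from $f$, automorphisms of $G$, and the projections by a sequence of compositions of operations. $f$ and $g$ are equivalent iff each generates the other. $g$ is trivial iff it is equivalent to the identity function on $V$. A $k$-ary $f$ is minimal iff it is not trivial, and all non-trivial functions $g$ generated by $f$ have arity at least $k$ and are equivalent to $f$. Special operations (each unique up to equivalence): $e_E\colon V\to V$ is a fixed injection whose image induces a complete subgraph of $G$; $e_N\colon V\to V$ is a fixed injection whose image induces an independent set in $G$; $-\colon V\to V$ is a fixed isomorphism between $G$ and its complement graph, i.e. a permutation with $(-x,-y)\in E$ iff $(x,y)\in N$ for all $x\ne y$. Fix $0\in V$; flipping the edges and non-edges between $\{0\}$ and $V\setminus\{0\}$ gives a graph isomorphic to $G$, and $\mathrm{sw}\colon V\to V$ (the switch) is a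 fixed such isomorphism: a permutation such that for distinct $x,y\in V\setminus\{0\}$, $(\mathrm{sw}(x),\mathrm{sw}(y))\in E$ iff $(x,y)\in E$, and for $x\neq 0$, $(\mathrm{sw}(x),\mathrm{sw}(0))\in E$ iff $(x,0)\in N$. *)

theory Defs
  imports Main "HOL-Library.Countable_Set"
begin

text \<open>The vertex set is the universe of the type \<open>'v\<close>.\<close>

definition random_graph :: "('v \<times> 'v) set \<Rightarrow> bool" where
  "random_graph E \<longleftrightarrow>
     countable (UNIV :: 'v set) \<and> infinite (UNIV :: 'v set) \<and> sym E \<and> irrefl E \<and>
     (\<forall>U U'. finite U \<and> finite U' \<and> U \<inter> U' = {} \<longrightarrow>
        (\<exists>v. v \<notin> U \<union> U' \<and> (\<forall>u\<in>U. (v, u) \<in> E) \<and> (\<forall>u\<in>U'. (v, u) \<notin> E)))"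

definition non_edges :: "('v \<times> 'v) set \<Rightarrow> ('v \<times> 'v) set" where
  "non_edges E = {(x, y). (x, y) \<notin> E \<and> x \<noteq> y}"

definition automorphisms :: "('v \<times> 'v) set \<Rightarrow> ('v \<Rightarrow> 'v) set" where
  "automorphisms E = {a. bij a \<and> (\<forall>x y. (a x, a y) \<in> E \<longleftrightarrow> (x, y) \<in> E)}"

text \<open>
  A pair \<open>(k, f)\<close> stands for the \<open>k\<close>-ary operation obtained by restricting \<open>f\<close> to lists of
  length \<open>k\<close>. The values of \<open>f\<close> on lists of other lengths are irrelevant to all notions below.
\<close>
type_synonym 'v operation = "nat \<times> ('v list \<Rightarrow> 'v)"

definition unary :: "('v \<Rightarrow> 'v) \<Rightarrow> 'v operation" where
  "unary f = (1, \<lambda>xs. f (xs ! 0))"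

text \<open>
  Since projections have positive arity, a set \<open>F\<close> of operations of positive arity yields
  only operations of positive arity.
\<close>
inductive_set clone :: "'v operation set \<Rightarrow> 'v operation set" for F where
  base: "(k, f) \<in> F \<Longrightarrow> (k, f) \<in> clone F"
| proj: "i < n \<Longrightarrow> (n, \<lambda>xs. xs ! i) \<in> clone F"
| comp: "(k, f) \<in> clone F \<Longrightarrow> length gs = k \<Longrightarrow> (\<And>g. g \<in> set gs \<Longrightarrow> (n, g) \<in> clone F) \<Longrightarrow>
         (n, \<lambda>xs. f (map (\<lambda>g. g xs) gs)) \<in> clone F"

definition generates :: "('v \<times> 'v) set \<Rightarrow> 'v operation \<Rightarrow> 'v operation \<Rightarrow> bool" where
  "generates E f g \<longleftrightarrow>
     (\<forall>S. finite S \<and> S \<subseteq> {xs. length xs = fst g} \<longrightarrow>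
        (\<exists>h. (fst g, h) \<in> clone (insert f (unary ` automorphisms E)) \<and>
             (\<forall>xs\<in>S. snd g xs = h xs)))"

definition equivalent :: "('v \<times> 'v) set \<Rightarrow> 'v operation \<Rightarrow> 'v operation \<Rightarrow> bool" where
  "equivalent E f g \<longleftrightarrow> generates E f g \<and> generates E g f"

definition trivial :: "('v \<times> 'v) set \<Rightarrow> 'v operation \<Rightarrow> bool" where
  "trivial E g \<longleftrightarrow> equivalent E g (unary id)"

definition minimal :: "('v \<times> 'v) set \<Rightarrow> 'v operation \<Rightarrow> bool" where
  "minimal E f \<longleftrightarrow> \<not> trivial E f \<and>
     (\<forall>g. generates E f g \<and> \<not> trivial E g \<longrightarrow> fst f \<le> fst g \<and> equivalent E f g)"

definition is_e_E :: "('v \<times> 'v) set \<Rightarrow> ('v \<Rightarrow> 'v) \<Rightarrow> bool" where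
  "is_e_E E e \<longleftrightarrow> inj e \<and> (\<forall>u\<in>range e. \<forall>v\<in>range e. u \<noteq> v \<longrightarrow> (u, v) \<in> E)"

definition is_e_N :: "('v \<times> 'v) set \<Rightarrow> ('v \<Rightarrow> 'v) \<Rightarrow> bool" where
  "is_e_N E e \<longleftrightarrow> inj e \<and> (\<forall>u\<in>range e. \<forall>v\<in>range e. (u, v) \<notin> E)"

definition is_minus :: "('v \<times> 'v) set \<Rightarrow> ('v \<Rightarrow> 'v) \<Rightarrow> bool" where
  "is_minus E m \<longleftrightarrow> bij m \<and>
     (\<forall>x y. x \<noteq> y \<longrightarrow> ((m x, m y) \<in> E \<longleftrightarrow> (x, y) \<in> non_edges E))"

definition is_switch :: "('v \<times> 'v) set \<Rightarrow> 'v \<Rightarrow> ('v \<Rightarrow> 'v) \<Rightarrow> bool" where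
  "is_switch E z s \<longleftrightarrow> bij s \<and>
     (\<forall>x y. x \<noteq> y \<and> x \<noteq> z \<and> y \<noteq> z \<longrightarrow> ((s x, s y) \<in> E \<longleftrightarrow> (x, y) \<in> E)) \<and>
     (\<forall>x. x \<noteq> z \<longrightarrow> ((s x, s z) \<in> E \<longleftrightarrow> (x, z) \<in> non_edges E))"

end

theory Submission
  imports Defs "HOL-Library.Ramsey"
begin

text \<open>
  The unary operations generated by \<open>f\<close> are those that agree on every finite set with a word in \<open>f\<close>
  and automorphisms, and finite partial isomorphisms of the random graph extend to automorphisms.
  So it only matters which finite graphs are carried to which others by words (\<open>reach\<close>). The heart
  of the theorem is \<open>generates_one_of_five\<close>: if \<open>f\<close> is not a self-embedding, then it generates a
  constant, \<open>e_N\<close>, \<open>e_E\<close>, \<open>-\<close> or \<open>sw\<close>. Minimality upgrades this to equivalence. The five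
  operations are told apart by properties that words inherit: injectivity, preservation of
  edges, preservation of non-edges, and, for \<open>-\<close> against \<open>sw\<close>, altering either all pairs or none.

  To find regular behaviour of an injective \<open>f\<close>, call a set of vertices large if it contains a
  realisation of every finite extension of some fixed finite type. Sets that are not large form an
  ideal. Two large sets can be shrunk so that edges between them have one fixed outcome under \<open>f\<close>,
  in the sense that this outcome can be met inside all large subsets, and likewise for non-edges
  (\<open>behaves_exists\<close>). Choosing vertices one at a time while the other sets stay large then realises
  every finite graph with the prescribed outcomes (\<open>selection\<close>). With the finite Ramsey theorem
  this yields copies of any finite graph on which \<open>f\<close> treats all edges alike and all non-edges
  alike: it keeps the graph, complements it, or maps it to a complete or an edgeless graph.

  Suppose that \<open>f\<close> is injective and generates none of \<open>e_N\<close>, \<open>e_E\<close>, \<open>-\<close>, \<open>sw\<close> (\<open>tame\<close>). Then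
  for large graphs only the first alternative remains. The same is shown between two different
  large sets and, finally, between a vertex and a large set. Any other behaviour there would be
  an operation that changes only the pairs at one vertex \<open>s\<close> of an arbitrary finite graph; changing
  all of them is a switch, and making all of them edges (or non-edges), for one vertex after the
  other, gives \<open>e_E\<close> (or \<open>e_N\<close>). Hence for each vertex \<open>c\<close> the vertices \<open>y\<close> such that \<open>f\<close> changes
  the pair \<open>{c, y}\<close> form a set that is not large (\<open>tame_bad_thin\<close>). If \<open>f\<close> changed some pair
  \<open>{c, d}\<close>, then any finite graph with a marked pair of the same kind as \<open>{c, d}\<close> would have a copy
  with the marked pair at \<open>c\<close> and \<open>d\<close> and no other pair changed. Repeating this, \<open>f\<close> would remove
  the edges (or add the missing ones) of any finite graph one by one and generate \<open>e_N\<close> (or \<open>e_E\<close>).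
  So a tame \<open>f\<close> is a self-embedding.

  A non-injective \<open>f\<close> collapses an edge or a non-edge. If words collapse both kinds, every finite
  set can be collapsed to a point. If only one kind is ever collapsed, pairs of the other kind keep
  their kind, and the same descent applies to \<open>e_N\<close> or \<open>e_E\<close> (\<open>not_inj_dichotomy\<close>).
\<close>

section \<open>Unary generation and words\<close>

text \<open>
  These are the functions that arise from \<open>f\<close> and the automorphisms by composition alone. They
  suffice because an operation in the clone of essentially unary operations is essentially unary.
\<close>

inductive_set words :: "('v \<times> 'v) set \<Rightarrow> ('v \<Rightarrow> 'v) \<Rightarrow> ('v \<Rightarrow> 'v) set" for E f where
  words_aut: "a \<in> automorphisms E \<Longrightarrow> a \<in> words E f"
| words_gen: "f \<in> words E f"
| words_comp: "g \<in> words E f \<Longrightarrow> h \<in> words E f \<Longrightarrow> g \<circ> h \<in> words E f"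

lemma id_automorphism: "id \<in> automorphisms E"
  by (simp add: automorphisms_def)

text \<open>
  Composing essentially unary operations selects one argument again: the outer operation reads
  only its \<open>i\<close>-th argument, so only the \<open>i\<close>-th inner operation matters.
\<close>

lemma clone_unary_imp_word:
  assumes "(n, h) \<in> clone (insert (unary f) (unary ` automorphisms E))"
  shows "\<exists>w\<in>words E f. \<exists>i<n. h = (\<lambda>xs. w (xs ! i))"
  using assms
proof (induction rule: clone.induct)
  case (base k h)
  then obtain g where "g \<in> words E f" "(k, h) = unary g"
    by (auto intro: words.intros)
  then show ?case by (auto simp: unary_def)
next
  case (proj i n)
  have "id \<in> words E f" by (simp add: words_aut id_automorphism)
  with proj show ?case by (metis id_apply)
next
  case (comp k h gs n)
  then obtain w i where w: "w \<in> words E f" "i < k" "h = (\<lambda>xs. w (xs ! i))" by blast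
  with comp have "gs ! i \<in> set gs" by simp
  with comp obtain w' j where w': "w' \<in> words E f" "j < n" "gs ! i = (\<lambda>xs. w' (xs ! j))"
    by blast
  have "(\<lambda>xs. h (map (\<lambda>g. g xs) gs)) = (\<lambda>xs. (w \<circ> w') (xs ! j))"
    using w w' comp(2) by simp
  moreover have "w \<circ> w' \<in> words E f" using w w' by (simp add: words_comp)
  ultimately show ?case using w'(2) by blast
qed

lemma word_imp_clone_unary:
  assumes "w \<in> words E f"
  shows "unary w \<in> clone (insert (unary f) (unary ` automorphisms E))"
  using assms
proof (induction rule: words.induct)
  case (words_aut a)
  then show ?case unfolding unary_def by (intro clone.base) (auto simp: unary_def)
next
  case words_gen
  then show ?case unfolding unary_def by (intro clone.base) (auto simp: unary_def)
next
  case (words_comp g h)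
  let ?H = "\<lambda>xs. h (xs ! 0)"
  have "(1, \<lambda>xs. (\<lambda>xs. g (xs ! 0)) (map (\<lambda>k. k xs) [?H]))
      \<in> clone (insert (unary f) (unary ` automorphisms E))"
    by (rule clone.comp[of 1]) (use words_comp.IH in \<open>auto simp: unary_def\<close>)
  then show ?case by (simp add: unary_def)
qed

lemma generates_unary_iff:
  "generates E (unary f) (unary g) \<longleftrightarrow>
     (\<forall>S. finite S \<longrightarrow> (\<exists>w\<in>words E f. \<forall>x\<in>S. g x = w x))"
proof (intro iffI allI impI)
  fix S :: "'a set"
  assume gen: "generates E (unary f) (unary g)" and "finite S"
  let ?T = "(\<lambda>x. [x]) ` S"
  have "finite ?T \<and> ?T \<subseteq> {xs. length xs = fst (unary g)}"
    using \<open>finite S\<close> by (auto simp: unary_def)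
  then obtain h where h: "(1, h) \<in> clone (insert (unary f) (unary ` automorphisms E))"
    "\<forall>xs\<in>?T. snd (unary g) xs = h xs"
    using gen unfolding generates_def by (auto simp: unary_def)
  then show "\<exists>w\<in>words E f. \<forall>x\<in>S. g x = w x"
    using clone_unary_imp_word[OF h(1)] by (auto simp: unary_def)
next
  assume *: "\<forall>S. finite S \<longrightarrow> (\<exists>w\<in>words E f. \<forall>x\<in>S. g x = w x)"
  show "generates E (unary f) (unary g)"
    unfolding generates_def
  proof (intro allI impI)
    fix S :: "'a list set" assume S: "finite S \<and> S \<subseteq> {xs. length xs = fst (unary g)}"
    then have "finite ((\<lambda>xs. xs ! 0) ` S)" by simp
    then obtain w where "w \<in> words E f" "\<forall>x\<in>(\<lambda>xs. xs ! 0) ` S. g x = w x"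
      using * by blast
    then show "\<exists>h. (fst (unary g), h) \<in> clone (insert (unary f) (unary ` automorphisms E)) \<and>
             (\<forall>xs\<in>S. snd (unary g) xs = h xs)"
      using word_imp_clone_unary[of w E f]
      by (intro exI[of _ "\<lambda>xs. w (xs ! 0)"]) (auto simp: unary_def)
  qed
qed

lemma generates_unaryD:
  assumes "generates E (unary f) (unary g)" "finite S"
  shows "\<exists>w\<in>words E f. \<forall>x\<in>S. g x = w x"
  using assms by (simp add: generates_unary_iff)

lemma generates_unary_trans:
  assumes fg: "generates E (unary f) (unary g)" and gh: "generates E (unary g) (unary h)"
  shows "generates E (unary f) (unary h)"
proof -
  have word: "\<exists>w'\<in>words E f. \<forall>x\<in>S. w x = w' x" if "w \<in> words E g" "finite S" for w S
    using that
  proof (induction arbitrary: S rule: words.induct)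
    case (words_aut a)
    then show ?case by (blast intro: words.words_aut)
  next
    case words_gen
    then show ?case using fg by (simp add: generates_unary_iff)
  next
    case (words_comp u v)
    obtain v' where v': "v' \<in> words E f" "\<forall>x\<in>S. v x = v' x" using words_comp by blast
    obtain u' where u': "u' \<in> words E f" "\<forall>x\<in>v ` S. u x = u' x"
      using words_comp by (meson finite_imageI)
    show ?case using u' v' by (intro bexI[of _ "u' \<circ> v'"]) (auto intro: words.words_comp)
  qed
  show ?thesis
    unfolding generates_unary_iff
  proof (intro allI impI)
    fix S :: "'a set" assume "finite S"
    then obtain w where "w \<in> words E g" "\<forall>x\<in>S. h x = w x"
      using gh by (auto simp: generates_unary_iff)
    with word[OF this(1) \<open>finite S\<close>] show "\<exists>w\<in>words E f. \<forall>x\<in>S. h x = w x" by auto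
  qed
qed

section \<open>Homogeneity of the random graph\<close>

locale rado =
  fixes E :: "('v \<times> 'v) set"
  assumes rg: "random_graph E"
begin

abbreviation adj :: "'v \<Rightarrow> 'v \<Rightarrow> bool" where
  "adj x y \<equiv> (x, y) \<in> E"

lemma adj_commute: "adj x y \<longleftrightarrow> adj y x"
  using rg by (auto simp: random_graph_def dest: symD)

lemma not_adj_self: "\<not> adj x x"
  using rg by (auto simp: random_graph_def irrefl_def)

lemma extension:
  assumes "finite C"
  obtains v where "v \<notin> C" "\<And>c. c \<in> C \<Longrightarrow> adj v c \<longleftrightarrow> \<tau> c"
proof -
  have "finite {c\<in>C. \<tau> c} \<and> finite {c\<in>C. \<not> \<tau> c} \<and> {c\<in>C. \<tau> c} \<inter> {c\<in>C. \<not> \<tau> c} = {}"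
    using assms by auto
  then obtain v where "v \<notin> {c\<in>C. \<tau> c} \<union> {c\<in>C. \<not> \<tau> c}"
    "\<forall>u\<in>{c\<in>C. \<tau> c}. adj v u" "\<forall>u\<in>{c\<in>C. \<not> \<tau> c}. \<not> adj v u"
    using rg unfolding random_graph_def by meson
  then show ?thesis by (intro that[of v]) auto
qed

definition partial_iso :: "('v \<times> 'v) set \<Rightarrow> bool" where
  "partial_iso p \<longleftrightarrow> finite p \<and>
     (\<forall>(x, y)\<in>p. \<forall>(x', y')\<in>p. (x = x' \<longleftrightarrow> y = y') \<and> (adj x x' \<longleftrightarrow> adj y y'))"

lemma partial_iso_converse: "partial_iso p \<Longrightarrow> partial_iso (p\<inverse>)"
  unfolding partial_iso_def by fastforce

lemma partial_iso_forth:
  assumes p: "partial_iso p"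
  shows "\<exists>q. partial_iso q \<and> p \<subseteq> q \<and> v \<in> Domain q"
proof (cases "v \<in> Domain p")
  case True
  then show ?thesis using p by blast
next
  case False
  have "finite (Range p)" using p by (simp add: partial_iso_def finite_Range)
  then obtain w where w: "w \<notin> Range p"
    "\<And>c. c \<in> Range p \<Longrightarrow> adj w c \<longleftrightarrow> (\<exists>b. (b, c) \<in> p \<and> adj v b)"
    using extension[of "Range p" "\<lambda>c. \<exists>b. (b, c) \<in> p \<and> adj v b"] by blast
  have new: "v \<noteq> x \<and> w \<noteq> y \<and> (adj v x \<longleftrightarrow> adj w y)" if "(x, y) \<in> p" for x y
  proof -
    have "b = x" if "(b, y) \<in> p" for b
      using p that \<open>(x, y) \<in> p\<close> unfolding partial_iso_def by fastforce
    then have "(\<exists>b. (b, y) \<in> p \<and> adj v b) \<longleftrightarrow> adj v x" using that by blast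
    then show ?thesis using w False that by blast
  qed
  have "partial_iso (insert (v, w) p)"
    using p new unfolding partial_iso_def
    by (auto simp: not_adj_self adj_commute[of _ v] adj_commute[of _ w])
  then show ?thesis by blast
qed

lemma partial_iso_back_and_forth:
  assumes "partial_iso p"
  shows "\<exists>q. partial_iso q \<and> p \<subseteq> q \<and> v \<in> Domain q \<and> v \<in> Range q"
proof -
  obtain q where q: "partial_iso q" "p \<subseteq> q" "v \<in> Domain q"
    using partial_iso_forth[OF assms] by blast
  obtain r where r: "partial_iso r" "q\<inverse> \<subseteq> r" "v \<in> Domain r"
    using partial_iso_forth[OF partial_iso_converse[OF q(1)]] by blast
  show ?thesis
    using q r partial_iso_converse[OF r(1)] by (intro exI[of _ "r\<inverse>"]) auto
qed

text \<open>
  Back and forth along an enumeration of the vertices: the union of the resulting chain of finite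
  partial isomorphisms is total and surjective.
\<close>

lemma partial_iso_extends:
  assumes p: "partial_iso p"
  shows "\<exists>a\<in>automorphisms E. \<forall>(x, y)\<in>p. a x = y"
proof -
  define e :: "nat \<Rightarrow> 'v" where "e = from_nat_into UNIV"
  have surj_e: "\<exists>n. e n = v" for v
    using rg from_nat_into_surj[of UNIV v] by (auto simp: e_def random_graph_def)
  have "\<exists>P. P 0 = p \<and> (\<forall>n. partial_iso (P n)) \<and>
      (\<forall>n. P n \<subseteq> P (Suc n) \<and> e n \<in> Domain (P (Suc n)) \<and> e n \<in> Range (P (Suc n)))"
    using dependent_nat_choice[of "\<lambda>n q. partial_iso q \<and> (n = 0 \<longrightarrow> q = p)"
        "\<lambda>n q q'. q \<subseteq> q' \<and> e n \<in> Domain q' \<and> e n \<in> Range q'"]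
      partial_iso_back_and_forth p by (metis nat.distinct(1))
  then obtain P where P: "P 0 = p" "\<And>n. partial_iso (P n)" "\<And>n. P n \<subseteq> P (Suc n)"
    "\<And>n. e n \<in> Domain (P (Suc n))" "\<And>n. e n \<in> Range (P (Suc n))"
    by blast
  have mono: "P m \<subseteq> P n" if "m \<le> n" for m n
    using lift_Suc_mono_le[of P, OF P(3) that] .
  define F where "F = (\<Union>n. P n)"
  have iso: "(x = x' \<longleftrightarrow> y = y') \<and> (adj x x' \<longleftrightarrow> adj y y')"
    if "(x, y) \<in> F" "(x', y') \<in> F" for x y x' y'
  proof -
    obtain m n where "(x, y) \<in> P m" "(x', y') \<in> P n" using \<open>(x, y) \<in> F\<close> \<open>(x', y') \<in> F\<close> by (auto simp: F_def)
    then have "(x, y) \<in> P (max m n)" "(x', y') \<in> P (max m n)"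
      using mono[of m "max m n"] mono[of n "max m n"] by auto
    then show ?thesis using P(2)[of "max m n"] unfolding partial_iso_def by fast
  qed
  have "\<exists>y. (x, y) \<in> F" for x using P(4) surj_e[of x] unfolding F_def by blast
  then obtain a where a: "\<And>x. (x, a x) \<in> F" by metis
  have "\<exists>x. (x, y) \<in> F" for y using P(5) surj_e[of y] unfolding F_def by blast
  then have "surj a" unfolding surj_def by (metis a iso)
  moreover have "inj a" by (metis a iso injI)
  ultimately have "a \<in> automorphisms E"
    using iso[OF a a] by (simp add: automorphisms_def bij_def)
  moreover have "a x = y" if "(x, y) \<in> p" for x y
  proof -
    have "(x, y) \<in> F" using that P(1) by (auto simp: F_def)
    then show ?thesis using a iso by blast
  qed
  ultimately show ?thesis by blast
qed

text \<open>
  A graph \<open>A\<close> on the index set \<open>S\<close> is a relation whose values on the diagonal are ignored; \<open>x\<close> is an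
  induced copy of it in the random graph.
\<close>

definition realizes :: "('i \<Rightarrow> 'v) \<Rightarrow> 'i set \<Rightarrow> ('i \<Rightarrow> 'i \<Rightarrow> bool) \<Rightarrow> bool" where
  "realizes x S A \<longleftrightarrow>
     inj_on x S \<and> (\<forall>i\<in>S. \<forall>j\<in>S. i \<noteq> j \<longrightarrow> (adj (x i) (x j) \<longleftrightarrow> A i j))"

text \<open>
  Stated for indexed copies of a graph instead of sets of pairs, so that the copies produced by
  different words can be matched.
\<close>

lemma homogeneity:
  assumes "finite S" and x: "realizes x S A" and y: "realizes y S A"
  obtains a where "a \<in> automorphisms E" "\<And>i. i \<in> S \<Longrightarrow> a (x i) = y i"
proof -
  have "adj (x i) (x j) \<longleftrightarrow> adj (y i) (y j)" if "i \<in> S" "j \<in> S" for i j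
    using x y that by (cases "i = j") (auto simp: realizes_def not_adj_self)
  then have "partial_iso ((\<lambda>i. (x i, y i)) ` S)"
    using assms by (auto simp: partial_iso_def realizes_def inj_on_def)
  from partial_iso_extends[OF this] show ?thesis using that by auto
qed

lemma homogeneity_pair:
  assumes "x \<noteq> y" "x' \<noteq> y'" "adj x y \<longleftrightarrow> adj x' y'"
  obtains a where "a \<in> automorphisms E" "a x = x'" "a y = y'"
proof -
  have "partial_iso {(x, x'), (y, y')}"
    using assms by (auto simp: partial_iso_def not_adj_self adj_commute[of y] adj_commute[of y'])
  from partial_iso_extends[OF this] show ?thesis using that by auto
qed

lemma homogeneity_point:
  obtains a where "a \<in> automorphisms E" "a x = x'"
proof -
  have "partial_iso {(x, x')}" by (auto simp: partial_iso_def not_adj_self)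
  from partial_iso_extends[OF this] show ?thesis using that by auto
qed

section \<open>Large sets of vertices\<close>

text \<open>
  The types over finite sets, each identified with the set of its realisations, are a base of a
  topology on the vertices. This says that \<open>Y\<close> is dense in the basic open set given by \<open>\<sigma>\<close> over
  \<open>P\<close>, so the large sets below are the somewhere dense ones.
\<close>

definition dense_over :: "'v set \<Rightarrow> ('v \<Rightarrow> bool) \<Rightarrow> 'v set \<Rightarrow> bool" where
  "dense_over P \<sigma> Y \<longleftrightarrow> (\<forall>C \<tau>. finite C \<and> P \<subseteq> C \<and> (\<forall>c\<in>P. \<tau> c = \<sigma> c) \<longrightarrow>
     (\<exists>v\<in>Y. v \<notin> C \<and> (\<forall>c\<in>C. adj v c \<longleftrightarrow> \<tau> c)))"

definition large :: "'v set \<Rightarrow> bool" where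
  "large Y \<longleftrightarrow> (\<exists>P \<sigma>. finite P \<and> dense_over P \<sigma> Y)"

lemma dense_overD:
  assumes "dense_over P \<sigma> Y" "finite C" "P \<subseteq> C" "\<forall>c\<in>P. \<tau> c = \<sigma> c"
  shows "\<exists>v\<in>Y. v \<notin> C \<and> (\<forall>c\<in>C. adj v c \<longleftrightarrow> \<tau> c)"
  using assms by (simp add: dense_over_def)

lemma large_mono:
  assumes "large Y" "Y \<subseteq> Z"
  shows "large Z"
proof -
  obtain P \<sigma> where P: "finite P" "dense_over P \<sigma> Y" using assms(1) unfolding large_def by blast
  have "dense_over P \<sigma> Z"
    unfolding dense_over_def
  proof (intro allI impI)
    fix C \<tau> assume "finite C \<and> P \<subseteq> C \<and> (\<forall>c\<in>P. \<tau> c = \<sigma> c)"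
    then show "\<exists>v\<in>Z. v \<notin> C \<and> (\<forall>c\<in>C. adj v c \<longleftrightarrow> \<tau> c)"
      using dense_overD[OF P(2), of C \<tau>] assms(2) by blast
  qed
  with P(1) show ?thesis unfolding large_def by blast
qed

lemma large_type:
  assumes "finite C"
  shows "large {v. v \<notin> C \<and> (\<forall>c\<in>C. adj v c \<longleftrightarrow> \<tau> c)}"
proof -
  have "dense_over C \<tau> {v. v \<notin> C \<and> (\<forall>c\<in>C. adj v c \<longleftrightarrow> \<tau> c)}"
    unfolding dense_over_def
  proof (intro allI impI)
    fix D \<rho> assume D: "finite D \<and> C \<subseteq> D \<and> (\<forall>c\<in>C. \<rho> c = \<tau> c)"
    obtain v where "v \<notin> D" "\<And>c. c \<in> D \<Longrightarrow> adj v c \<longleftrightarrow> \<rho> c"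
      by (rule extension[of D \<rho>]) (use D in auto)
    with D show "\<exists>v\<in>{v. v \<notin> C \<and> (\<forall>c\<in>C. adj v c \<longleftrightarrow> \<tau> c)}. v \<notin> D \<and> (\<forall>c\<in>D. adj v c \<longleftrightarrow> \<rho> c)"
      by (intro bexI[of _ v]) auto
  qed
  then show ?thesis using assms unfolding large_def by blast
qed

text \<open>
  The exceptions are the parameters of the type witnessing that \<open>Y\<close> is large, as this type fixes
  their adjacency to the vertices it describes.
\<close>

lemma large_neighbours:
  assumes "large Y"
  obtains P where "finite P" "\<And>x b. x \<notin> P \<Longrightarrow> large {y \<in> Y. x \<noteq> y \<and> adj x y = b}"
proof -
  from assms obtain P \<sigma> where P: "finite P" "dense_over P \<sigma> Y" unfolding large_def by blast
  have "large {y \<in> Y. x \<noteq> y \<and> adj x y = b}" if x: "x \<notin> P" for x b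
  proof -
    have "dense_over (insert x P) (\<sigma>(x := b)) {y \<in> Y. x \<noteq> y \<and> adj x y = b}"
      unfolding dense_over_def
    proof (intro allI impI)
      fix C \<tau>
      assume C: "finite C \<and> insert x P \<subseteq> C \<and> (\<forall>c\<in>insert x P. \<tau> c = (\<sigma>(x := b)) c)"
      then have "\<forall>c\<in>P. \<tau> c = \<sigma> c" using x by auto
      then obtain v where v: "v \<in> Y" "v \<notin> C" "\<forall>c\<in>C. adj v c \<longleftrightarrow> \<tau> c"
        using dense_overD[OF P(2), of C \<tau>] C by blast
      moreover have "x \<in> C" "\<tau> x = b" using C by auto
      ultimately have "x \<noteq> v" "adj x v = b" using adj_commute by blast+
      with v show "\<exists>v\<in>{y \<in> Y. x \<noteq> y \<and> adj x y = b}. v \<notin> C \<and> (\<forall>c\<in>C. adj v c \<longleftrightarrow> \<tau> c)"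
        by blast
    qed
    then show ?thesis using P(1) unfolding large_def by blast
  qed
  then show ?thesis using that P(1) by blast
qed

text \<open>
  The reason why the sets that are not large form an ideal: a type witnessing that \<open>Y\<close> is large has
  an extension that \<open>Z\<close> omits, and everything in \<open>Y\<close> above that extension lies outside \<open>Z\<close>.
\<close>

lemma large_diff:
  assumes "large Y" "\<not> large Z"
  shows "large (Y - Z)"
proof -
  from assms(1) obtain P \<sigma> where P: "finite P" "dense_over P \<sigma> Y" unfolding large_def by blast
  then have "\<not> dense_over P \<sigma> Z" using assms(2) unfolding large_def by blast
  then obtain C \<tau> where C: "finite C" "P \<subseteq> C" "\<forall>c\<in>P. \<tau> c = \<sigma> c"
    "\<not> (\<exists>v\<in>Z. v \<notin> C \<and> (\<forall>c\<in>C. adj v c \<longleftrightarrow> \<tau> c))"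
    by (auto simp: dense_over_def)
  have "dense_over C \<tau> (Y - Z)"
    unfolding dense_over_def
  proof (intro allI impI)
    fix D \<rho> assume D: "finite D \<and> C \<subseteq> D \<and> (\<forall>c\<in>C. \<rho> c = \<tau> c)"
    then have "P \<subseteq> D" "\<forall>c\<in>P. \<rho> c = \<sigma> c" using C by auto
    then obtain v where v: "v \<in> Y" "v \<notin> D" "\<forall>c\<in>D. adj v c \<longleftrightarrow> \<rho> c"
      using dense_overD[OF P(2), of D \<rho>] D by blast
    then have "v \<notin> C \<and> (\<forall>c\<in>C. adj v c \<longleftrightarrow> \<tau> c)" using D by blast
    then have "v \<notin> Z" using C(4) by blast
    then show "\<exists>v\<in>Y - Z. v \<notin> D \<and> (\<forall>c\<in>D. adj v c \<longleftrightarrow> \<rho> c)" using v by blast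
  qed
  then show ?thesis using C(1) unfolding large_def by blast
qed

lemma large_split:
  assumes "large Y"
  shows "large {y \<in> Y. R y} \<or> large {y \<in> Y. \<not> R y}"
proof -
  have "Y - {y \<in> Y. R y} = {y \<in> Y. \<not> R y}" by blast
  then show ?thesis using large_diff[OF assms] by metis
qed

lemma large_adj_pair:
  assumes "large Y"
  obtains y y' where "y \<in> Y" "y' \<in> Y" "y \<noteq> y'" "adj y y' = b"
proof -
  from assms obtain P \<sigma> where P: "finite P" "dense_over P \<sigma> Y" unfolding large_def by blast
  obtain y where y: "y \<in> Y" "y \<notin> P" using dense_overD[OF P(2,1), of \<sigma>] by blast
  have "\<exists>v\<in>Y. v \<notin> insert y P \<and> (\<forall>c\<in>insert y P. adj v c \<longleftrightarrow> (\<sigma>(y := b)) c)"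
    by (rule dense_overD[OF P(2)]) (use P(1) y in auto)
  then obtain y' where "y' \<in> Y" "y' \<noteq> y" "adj y' y = b" by auto
  with y show ?thesis using that by blast
qed

lemma not_large_finite:
  assumes "finite F"
  shows "\<not> large F"
proof
  assume "large F"
  then obtain P \<sigma> where P: "finite P" "dense_over P \<sigma> F" unfolding large_def by blast
  have "\<exists>v\<in>F. v \<notin> P \<union> F \<and> (\<forall>c\<in>P \<union> F. adj v c \<longleftrightarrow> \<sigma> c)"
    by (rule dense_overD[OF P(2)]) (use P(1) assms in auto)
  then show False by blast
qed

lemma large_not_empty: "large Y \<Longrightarrow> Y \<noteq> {}"
  using not_large_finite by blast

section \<open>Realising finite graphs in large sets\<close>

text \<open>
  A notion of "\<open>Q\<close> can be arranged between \<open>X\<close> and \<open>Y\<close>" that is stable under passing to large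
  subsets. It asks for one vertex \<open>x\<close> only; \<open>good_large_witnesses\<close> shows that a large set of them
  follows, which is what allows one \<open>x\<close> to serve several sets \<open>Y\<close> at once.
\<close>

definition good :: "('v \<Rightarrow> 'v \<Rightarrow> bool) \<Rightarrow> 'v set \<Rightarrow> 'v set \<Rightarrow> bool" where
  "good Q X Y \<longleftrightarrow> (\<forall>X' \<subseteq> X. \<forall>Y' \<subseteq> Y. large X' \<longrightarrow> large Y' \<longrightarrow> (\<exists>x\<in>X'. large {y \<in> Y'. Q x y}))"

lemma good_subset: "good Q X Y \<Longrightarrow> X' \<subseteq> X \<Longrightarrow> Y' \<subseteq> Y \<Longrightarrow> good Q X' Y'"
  unfolding good_def by (meson order_trans)

text \<open>
  If the set of good witnesses in \<open>X'\<close> were not large, its complement in \<open>X'\<close> would be a large set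
  without any witness.
\<close>

lemma good_large_witnesses:
  assumes "good Q X Y" "X' \<subseteq> X" "large X'" "large Y"
  shows "large {x \<in> X'. large {y \<in> Y. Q x y}}"
proof (rule ccontr)
  assume "\<not> ?thesis"
  from large_diff[OF assms(3) this] have "large {x \<in> X'. \<not> large {y \<in> Y. Q x y}}"
    by (rule large_mono) blast
  moreover have "{x \<in> X'. \<not> large {y \<in> Y. Q x y}} \<subseteq> X" using assms(2) by blast
  ultimately show False using assms(1,4) unfolding good_def by blast
qed

text \<open>
  If one outcome of \<open>R\<close> is not good for \<open>X\<close> and \<open>Y\<close>, there are large \<open>X1\<close> and \<open>Y1\<close> such that no
  vertex of \<open>X1\<close> has a large set of partners in \<open>Y1\<close> with this outcome. As almost every vertex has a
  large set of neighbours (and of non-neighbours) in any large subset of \<open>Y1\<close>, the opposite outcome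
  must be the large one there.
\<close>

lemma good_dichotomy:
  fixes R :: "'v \<Rightarrow> 'v \<Rightarrow> bool"
  assumes X: "large X" and Y: "large Y"
  obtains X' Y' c where "X' \<subseteq> X" "Y' \<subseteq> Y" "large X'" "large Y'"
    "good (\<lambda>x y. x \<noteq> y \<and> adj x y = b \<and> R x y = c) X' Y'"
proof (cases "good (\<lambda>x y. x \<noteq> y \<and> adj x y = b \<and> R x y = True) X Y")
  case True
  then show ?thesis by (rule that[OF subset_refl subset_refl X Y])
next
  case False
  then obtain X1 Y1 where X1: "X1 \<subseteq> X" "large X1" and Y1: "Y1 \<subseteq> Y" "large Y1"
    and bad: "\<And>x. x \<in> X1 \<Longrightarrow> \<not> large {y \<in> Y1. x \<noteq> y \<and> adj x y = b \<and> R x y = True}"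
    by (auto simp: good_def)
  have "good (\<lambda>x y. x \<noteq> y \<and> adj x y = b \<and> R x y = False) X1 Y1"
    unfolding good_def
  proof (intro allI impI)
    fix X' Y' assume X': "X' \<subseteq> X1" "large X'" and Y': "Y' \<subseteq> Y1" "large Y'"
    obtain P where P: "finite P" "\<And>x b. x \<notin> P \<Longrightarrow> large {y \<in> Y'. x \<noteq> y \<and> adj x y = b}"
      using large_neighbours[OF Y'(2)] by blast
    have "large (X' - P)" using large_diff[OF X'(2)] not_large_finite[OF P(1)] by blast
    then obtain x where x: "x \<in> X'" "x \<notin> P" using large_not_empty by blast
    have "\<not> large {y \<in> Y1. x \<noteq> y \<and> adj x y = b \<and> R x y = True}" using bad x X' by blast
    then have "large ({y \<in> Y'. x \<noteq> y \<and> adj x y = b} -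
        {y \<in> Y1. x \<noteq> y \<and> adj x y = b \<and> R x y = True})"
      using P(2)[OF x(2)] large_diff by blast
    then have "large {y \<in> Y'. x \<noteq> y \<and> adj x y = b \<and> R x y = False}"
      by (rule large_mono) (use Y' in blast)
    then show "\<exists>x\<in>X'. large {y \<in> Y'. x \<noteq> y \<and> adj x y = b \<and> R x y = False}" using x by blast
  qed
  then show ?thesis by (rule that[OF X1(1) Y1(1) X1(2) Y1(2)])
qed

text \<open>
  The function \<open>h\<close> records what \<open>f\<close> does to pairs between \<open>X\<close> and \<open>Y\<close>: \<open>h True\<close> is the outcome
  for edges, \<open>h False\<close> for non-edges. So \<open>id\<close> is preservation, \<open>Not\<close> exchanges edges and
  non-edges, and the constant functions make all pairs edges or all pairs non-edges.
\<close>

definition behaves :: "('v \<Rightarrow> 'v) \<Rightarrow> (bool \<Rightarrow> bool) \<Rightarrow> 'v set \<Rightarrow> 'v set \<Rightarrow> bool" where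
  "behaves f h X Y \<longleftrightarrow>
     (\<forall>b. good (\<lambda>x y. x \<noteq> y \<and> adj x y = b \<and> adj (f x) (f y) = h b) X Y)"

lemma behaves_subset:
  assumes "behaves f h X Y" "X' \<subseteq> X" "Y' \<subseteq> Y"
  shows "behaves f h X' Y'"
  using assms(1) good_subset[OF _ assms(2,3)] unfolding behaves_def by fast

lemma behaves_exists:
  assumes X: "large X" and Y: "large Y"
  obtains X' Y' h where "X' \<subseteq> X" "Y' \<subseteq> Y" "large X'" "large Y'" "behaves f h X' Y'"
proof -
  let ?Q = "\<lambda>b c x y. x \<noteq> y \<and> adj x y = b \<and> adj (f x) (f y) = c"
  obtain X1 Y1 c1 where 1: "X1 \<subseteq> X" "Y1 \<subseteq> Y" "large X1" "large Y1" "good (?Q True c1) X1 Y1"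
    by (rule good_dichotomy[OF X Y])
  obtain X2 Y2 c2 where 2: "X2 \<subseteq> X1" "Y2 \<subseteq> Y1" "large X2" "large Y2" "good (?Q False c2) X2 Y2"
    by (rule good_dichotomy[OF 1(3,4)])
  have "good (?Q b (if b then c1 else c2)) X2 Y2" for b
    using 2(5) good_subset[OF 1(5) 2(1,2)] by (cases b) (simp_all only: if_True if_False)
  then have "behaves f (\<lambda>b. if b then c1 else c2) X2 Y2" unfolding behaves_def by (rule allI)
  from that[OF order_trans[OF 2(1) 1(1)] order_trans[OF 2(2) 1(2)] 2(3,4) this] show ?thesis .
qed

text \<open>
  Each of the finitely many pairs is treated in turn; as \<open>D\<close> is inherited by subsets, later
  shrinking does not destroy what was achieved before.
\<close>

lemma shrink_pairwise:
  assumes dense: "\<And>X Y. large X \<Longrightarrow> large Y \<Longrightarrow>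
      \<exists>X' \<subseteq> X. \<exists>Y' \<subseteq> Y. large X' \<and> large Y' \<and> D X' Y'"
    and hereditary: "\<And>X Y X' Y'. D X Y \<Longrightarrow> X' \<subseteq> X \<Longrightarrow> Y' \<subseteq> Y \<Longrightarrow> D X' Y'"
    and "distinct is" "\<forall>i\<in>set is. large (X i)"
  shows "\<exists>Y. (\<forall>i\<in>set is. large (Y i) \<and> Y i \<subseteq> X i) \<and> sorted_wrt (\<lambda>i j. D (Y i) (Y j)) is"
proof -
  have one: "\<exists>Z' \<subseteq> Z. large Z' \<and> (\<exists>Y. \<forall>j\<in>set js. large (Y j) \<and> Y j \<subseteq> X j \<and> D Z' (Y j))"
    if "large Z" "distinct js" "\<And>j. j \<in> set js \<Longrightarrow> large (X j)" for Z js and X :: "'a \<Rightarrow> 'v set"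
    using that
  proof (induction js)
    case Nil
    then show ?case by auto
  next
    case (Cons j js)
    then obtain Z1 Y where Z1: "Z1 \<subseteq> Z" "large Z1"
      "\<forall>k\<in>set js. large (Y k) \<and> Y k \<subseteq> X k \<and> D Z1 (Y k)" by auto
    have "large (X j)" using Cons by simp
    from dense[OF Z1(2) this] obtain Z2 W where Z2: "Z2 \<subseteq> Z1" "large Z2" "W \<subseteq> X j" "large W" "D Z2 W"
      by blast
    have "\<forall>k\<in>set (j # js). large ((Y(j := W)) k) \<and> (Y(j := W)) k \<subseteq> X k \<and> D Z2 ((Y(j := W)) k)"
      using Z1 Z2 Cons.prems(2) hereditary[OF _ Z2(1)] by auto
    with order_trans[OF Z2(1) Z1(1)] Z2(2) show ?case
      by (intro exI[of _ Z2] exI[of _ "Y(j := W)"] conjI)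
  qed
  show ?thesis
    using assms(3,4)
  proof (induction "is")
    case Nil
    then show ?case by simp
  next
    case (Cons i "is")
    then obtain Y where Y: "\<forall>k\<in>set is. large (Y k) \<and> Y k \<subseteq> X k" "sorted_wrt (\<lambda>i j. D (Y i) (Y j)) is"
      by auto
    have "large (X i)" "distinct is" "i \<notin> set is" using Cons.prems by auto
    from one[OF this(1,2), of Y] Y(1) obtain Z' Y' where
      Z': "Z' \<subseteq> X i" "large Z'" "\<forall>j\<in>set is. large (Y' j) \<and> Y' j \<subseteq> Y j \<and> D Z' (Y' j)"
      by blast
    have "sorted_wrt (\<lambda>k j. D ((Y'(i := Z')) k) ((Y'(i := Z')) j)) is"
      by (rule sorted_wrt_mono_rel[OF _ Y(2)]) (use Z' \<open>i \<notin> set is\<close> hereditary in auto)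
    then have "sorted_wrt (\<lambda>k j. D ((Y'(i := Z')) k) ((Y'(i := Z')) j)) (i # is)"
      using Z' \<open>i \<notin> set is\<close> by auto
    moreover have "\<forall>k\<in>set (i # is). large ((Y'(i := Z')) k) \<and> (Y'(i := Z')) k \<subseteq> X k"
    proof
      fix k assume "k \<in> set (i # is)"
      then show "large ((Y'(i := Z')) k) \<and> (Y'(i := Z')) k \<subseteq> X k"
        using Z' Y(1) by (cases "k = i") (simp, force)
    qed
    ultimately show ?case by (intro exI[of _ "Y'(i := Z')"] conjI)
  qed
qed

text \<open>
  The first vertex is chosen so that it leaves a large set of suitable partners in each of the
  remaining sets. Goodness is inherited by these smaller sets, so the choice can be repeated.
  Which relation \<open>Q i j\<close> is wanted may depend on the pair of indices, hence every finite
  graph can be realised.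
\<close>

lemma selection:
  assumes "distinct is" "\<forall>i\<in>set is. large (X i)"
    "sorted_wrt (\<lambda>i j. good (Q i j) (X i) (X j)) is"
  shows "\<exists>x. (\<forall>i\<in>set is. x i \<in> X i) \<and> sorted_wrt (\<lambda>i j. Q i j (x i) (x j)) is"
  using assms
proof (induction "is" arbitrary: X)
  case Nil
  then show ?case by simp
next
  case (Cons i "is")
  have Xi: "large (X i)" using Cons.prems by simp
  have "large {a \<in> X i. \<forall>j\<in>set js. large {y \<in> X j. Q i j a y}}" if "set js \<subseteq> set is" for js
    using that
  proof (induction js)
    case Nil
    then show ?case using Xi by simp
  next
    case (Cons j js)
    then have "j \<in> set is" by simp
    then have "good (Q i j) (X i) (X j)" "large (X j)" using Cons.prems \<open>sorted_wrt _ (i # is)\<close>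
        \<open>\<forall>k\<in>set (i # is). large (X k)\<close> by auto
    moreover have "large {a \<in> X i. \<forall>j\<in>set js. large {y \<in> X j. Q i j a y}}" using Cons by simp
    ultimately have "large {x \<in> {a \<in> X i. \<forall>j\<in>set js. large {y \<in> X j. Q i j a y}}.
        large {y \<in> X j. Q i j x y}}"
      by (intro good_large_witnesses) auto
    then show ?case by (rule large_mono) auto
  qed
  from large_not_empty[OF this[OF order_refl]] obtain a where
    a: "a \<in> X i" "\<forall>j\<in>set is. large {y \<in> X j. Q i j a y}" by blast
  define X' where "X' = (\<lambda>j. {y \<in> X j. Q i j a y})"
  have "sorted_wrt (\<lambda>i j. good (Q i j) (X' i) (X' j)) is"
    by (rule sorted_wrt_mono_rel[of _ "\<lambda>i j. good (Q i j) (X i) (X j)"])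
      (use Cons.prems in \<open>auto simp: X'_def intro: good_subset\<close>)
  with Cons.IH[of X'] Cons.prems(1) a(2) obtain x where
    x: "\<forall>j\<in>set is. x j \<in> X' j" "sorted_wrt (\<lambda>i j. Q i j (x i) (x j)) is"
    unfolding X'_def by auto
  have "i \<notin> set is" using Cons.prems by simp
  have "sorted_wrt (\<lambda>k j. Q k j ((x(i := a)) k) ((x(i := a)) j)) is"
    by (rule sorted_wrt_mono_rel[OF _ x(2)]) (use \<open>i \<notin> set is\<close> in auto)
  then have "sorted_wrt (\<lambda>k j. Q k j ((x(i := a)) k) ((x(i := a)) j)) (i # is)"
    using x(1) \<open>i \<notin> set is\<close> by (auto simp: X'_def)
  moreover have "\<forall>k\<in>set (i # is). (x(i := a)) k \<in> X k"
    using x(1) a(1) by (auto simp: X'_def)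
  ultimately show ?case by (intro exI[of _ "x(i := a)"] conjI)
qed

lemma sorted_wrt_imp_pairwise:
  assumes "sorted_wrt P is" "symp P" "i \<in> set is" "j \<in> set is" "i \<noteq> j"
  shows "P i j"
  using assms(1,3-5)
proof (induction "is")
  case (Cons k ks)
  then show ?case using sympD[OF assms(2)] by auto
qed simp

lemma realization_by_selection:
  assumes "distinct is" "\<forall>i\<in>set is. large (X i)"
    and beh: "sorted_wrt (\<lambda>i j. behaves f (H i j) (X i) (X j)) is"
    and H: "\<And>i j. H i j = H j i" and A: "symp A"
  shows "\<exists>x. (\<forall>i\<in>set is. x i \<in> X i) \<and> realizes x (set is) A \<and>
    (\<forall>i\<in>set is. \<forall>j\<in>set is. i \<noteq> j \<longrightarrow> adj (f (x i)) (f (x j)) = H i j (A i j))"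
proof -
  let ?Q = "\<lambda>i j x y. x \<noteq> y \<and> adj x y = A i j \<and> adj (f x) (f y) = H i j (A i j)"
  have "sorted_wrt (\<lambda>i j. good (?Q i j) (X i) (X j)) is"
    by (rule sorted_wrt_mono_rel[OF _ beh]) (auto simp: behaves_def)
  from selection[OF assms(1,2) this] obtain x where
    x: "\<forall>i\<in>set is. x i \<in> X i" "sorted_wrt (\<lambda>i j. ?Q i j (x i) (x j)) is"
    by (elim exE conjE)
  have "symp (\<lambda>i j. ?Q i j (x i) (x j))"
  proof (rule sympI)
    fix i j assume "?Q i j (x i) (x j)"
    moreover have "A i j = A j i" using sympD[OF A] by blast
    ultimately show "?Q j i (x j) (x i)"
      using H[of i j] adj_commute[of "x i" "x j"] adj_commute[of "f (x i)" "f (x j)"] by auto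
  qed
  from sorted_wrt_imp_pairwise[OF x(2) this]
  have *: "?Q i j (x i) (x j)" if "i \<in> set is" "j \<in> set is" "i \<noteq> j" for i j
    using that by blast
  then have "realizes x (set is) A" unfolding realizes_def inj_on_def by blast
  with x(1) * show ?thesis by (intro exI[of _ x]) simp
qed

text \<open>
  Deleting the partners of \<open>x\<close> that violate \<open>P\<close> from the large set of its neighbours, or of its
  non-neighbours, leaves a large set.
\<close>

lemma good_off_thin:
  assumes thin: "\<And>x. \<not> large {y. x \<noteq> y \<and> \<not> P x y}"
  shows "good (\<lambda>x y. x \<noteq> y \<and> adj x y = b \<and> P x y) X Y"
  unfolding good_def
proof (intro allI impI)
  fix X' Y' assume X': "large X'" and Y': "large Y'"
  obtain F where F: "finite F" "\<And>x b. x \<notin> F \<Longrightarrow> large {y \<in> Y'. x \<noteq> y \<and> adj x y = b}"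
    using large_neighbours[OF Y'] by blast
  have "large (X' - F)" using large_diff[OF X'] not_large_finite[OF F(1)] by blast
  then obtain x where x: "x \<in> X'" "x \<notin> F" using large_not_empty by blast
  from large_diff[OF F(2)[OF x(2)] thin[of x]]
  have "large {y \<in> Y'. x \<noteq> y \<and> adj x y = b \<and> P x y}"
    by (rule large_mono) blast
  with x(1) show "\<exists>x\<in>X'. large {y \<in> Y'. x \<noteq> y \<and> adj x y = b \<and> P x y}" by blast
qed

lemma realization_off_thin:
  assumes thin: "\<And>x. \<not> large {y. x \<noteq> y \<and> \<not> P x y}"
    and P: "symp P" and A: "symp A"
    and "finite S" and large: "\<forall>i\<in>S. large (X i)"
  shows "\<exists>x. (\<forall>i\<in>S. x i \<in> X i) \<and> realizes x S A \<and>
    (\<forall>i\<in>S. \<forall>j\<in>S. i \<noteq> j \<longrightarrow> P (x i) (x j))"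
proof -
  obtain js where js: "set js = S" "distinct js" using finite_distinct_list[OF assms(4)] by blast
  let ?Q = "\<lambda>i j x y. x \<noteq> y \<and> adj x y = A i j \<and> P x y"
  have "sorted_wrt (\<lambda>i j. True) js" by (induction js) auto
  then have "sorted_wrt (\<lambda>i j. good (?Q i j) (X i) (X j)) js"
    by (rule sorted_wrt_mono_rel[rotated]) (rule good_off_thin[OF thin])
  moreover have "\<forall>i\<in>set js. large (X i)" using large js(1) by simp
  ultimately obtain x where
    x: "\<forall>i\<in>set js. x i \<in> X i" "sorted_wrt (\<lambda>i j. ?Q i j (x i) (x j)) js"
    using selection[OF js(2), of X ?Q] by (elim exE conjE meta_impE) auto
  have "symp (\<lambda>i j. ?Q i j (x i) (x j))"
  proof (rule sympI)
    fix i j assume "?Q i j (x i) (x j)"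
    moreover have "A i j = A j i" using sympD[OF A] by blast
    ultimately show "?Q j i (x j) (x i)"
      using sympD[OF P] adj_commute[of "x i" "x j"] by auto
  qed
  from sorted_wrt_imp_pairwise[OF x(2) this]
  have *: "?Q i j (x i) (x j)" if "i \<in> S" "j \<in> S" "i \<noteq> j" for i j
    using that unfolding js(1) by blast
  then have "realizes x S A" unfolding realizes_def inj_on_def by blast
  with x(1) * show ?thesis unfolding js(1) by (intro exI[of _ x]) simp
qed

lemma realization_exists:
  assumes "finite S" "symp A"
  obtains x where "realizes x S A"
proof -
  have "large UNIV" using large_type[of "{}"] by simp
  moreover have "\<not> large {y. x \<noteq> y \<and> \<not> True}" for x using not_large_finite by simp
  ultimately show ?thesis
    using realization_off_thin[of "\<lambda>_ _. True" A S "\<lambda>_. UNIV"] assms that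
    by (auto simp: symp_def)
qed

text \<open>
  This makes a single irregular pair \<open>{c, d}\<close> usable in every finite graph: later \<open>P\<close> says that \<open>f\<close>
  is harmless on a pair, while \<open>{c, d}\<close> is a pair on which it is not.
\<close>

lemma realization_through_pair:
  assumes thin: "\<And>x. \<not> large {y. x \<noteq> y \<and> \<not> P x y}"
    and P: "symp P" and A: "symp A"
    and S: "finite S" "s \<in> S" "t \<in> S" "s \<noteq> t" and c: "c \<noteq> d" "adj c d = A s t"
  shows "\<exists>x. realizes x S A \<and> x s = c \<and> x t = d \<and>
    (\<forall>i\<in>S. \<forall>j\<in>S. i \<noteq> j \<longrightarrow> {i, j} \<noteq> {s, t} \<longrightarrow> P (x i) (x j))"
proof -
  define T where "T i = {v. v \<notin> {c, d} \<and> (\<forall>u\<in>{c, d}. adj v u \<longleftrightarrow> (if u = c then A i s else A i t))}" for i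
  \<comment> \<open>The remaining vertices are sought among those of the right type over \<open>c\<close> and \<open>d\<close>,
    minus the two sets that are not large by assumption.\<close>
  define X where "X i = T i - {y. c \<noteq> y \<and> \<not> P c y} - {y. d \<noteq> y \<and> \<not> P d y}" for i
  have "large (T i)" for i unfolding T_def by (rule large_type) simp
  then have "large (X i)" for i unfolding X_def by (intro large_diff thin)
  then have "\<forall>i\<in>S - {s, t}. large (X i)" by simp
  from realization_off_thin[OF thin P A finite_Diff[OF S(1)] this] obtain y where
    y: "\<forall>i\<in>S - {s, t}. y i \<in> X i" "realizes y (S - {s, t}) A"
      "\<forall>i\<in>S - {s, t}. \<forall>j\<in>S - {s, t}. i \<noteq> j \<longrightarrow> P (y i) (y j)"
    by (elim exE conjE)
  define x where "x = y(s := c, t := d)"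
  define G where "G i j \<longleftrightarrow> x i \<noteq> x j \<and> adj (x i) (x j) = A i j \<and> ({i, j} \<noteq> {s, t} \<longrightarrow> P (x i) (x j))" for i j
  have sym: "G i j \<Longrightarrow> G j i" for i j
    using sympD[OF P, of "x i" "x j"] sympD[OF A, of i j] sympD[OF A, of j i]
      adj_commute[of "x i" "x j"]
    unfolding G_def by (auto simp: insert_commute)
  have [simp]: "x s = c" "x t = d" using S(4) by (auto simp: x_def)
  have st: "G s t" using c S unfolding G_def by simp
  have mixed: "G i s \<and> G i t" if i: "i \<in> S" "i \<noteq> s" "i \<noteq> t" for i
  proof -
    have "x i = y i" "y i \<in> X i" using i y(1) by (auto simp: x_def)
    then have "x i \<noteq> c" "x i \<noteq> d" "adj (x i) c = A i s" "adj (x i) d = A i t" "P c (x i)" "P d (x i)"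
      using c(1) unfolding X_def T_def by auto
    then show ?thesis using sympD[OF P, of c "x i"] sympD[OF P, of d "x i"] unfolding G_def by simp
  qed
  have inner: "G i j" if ij: "i \<in> S - {s, t}" "j \<in> S - {s, t}" "i \<noteq> j" for i j
  proof -
    have "y i \<noteq> y j" using y(2) ij unfolding realizes_def inj_on_def by blast
    moreover have "adj (y i) (y j) = A i j" using y(2) ij unfolding realizes_def by blast
    moreover have "P (y i) (y j)" using y(3) ij by blast
    ultimately show ?thesis using ij unfolding G_def x_def by simp
  qed
  have G: "G i j" if "i \<in> S" "j \<in> S" "i \<noteq> j" for i j
    using that st sym[OF st] mixed[of i] mixed[of j] sym[of j s] sym[of j t] inner[of i j]
    by auto
  then have "realizes x S A" unfolding realizes_def inj_on_def G_def by blast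
  moreover have "\<forall>i\<in>S. \<forall>j\<in>S. i \<noteq> j \<longrightarrow> {i, j} \<noteq> {s, t} \<longrightarrow> P (x i) (x j)"
    using G unfolding G_def by blast
  ultimately show ?thesis by (intro exI[of _ x] conjI) simp_all
qed

section \<open>Reachability between finite graphs\<close>

text \<open>
  The elements of \<open>S\<close> serve only as names: \<open>A\<close> and \<open>B\<close> need not be related to \<open>E\<close> on \<open>S\<close>. Using
  vertices as names lets \<open>S\<close> be taken as a set on which a given function is to be imitated.
\<close>

definition reach :: "('v \<Rightarrow> 'v) \<Rightarrow> 'v set \<Rightarrow> ('v \<Rightarrow> 'v \<Rightarrow> bool) \<Rightarrow> ('v \<Rightarrow> 'v \<Rightarrow> bool) \<Rightarrow> bool" where
  "reach f S A B \<longleftrightarrow> (\<exists>g\<in>words E f. \<exists>x. realizes x S A \<and> realizes (g \<circ> x) S B)"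

lemma realizes_adj: "inj_on x S \<Longrightarrow> realizes x S (\<lambda>i j. adj (x i) (x j))"
  by (simp add: realizes_def)

lemma realizes_cong:
  "realizes x S A \<Longrightarrow> (\<And>i j. i \<in> S \<Longrightarrow> j \<in> S \<Longrightarrow> i \<noteq> j \<Longrightarrow> A i j = B i j) \<Longrightarrow> realizes x S B"
  unfolding realizes_def by simp

text \<open>
  The copy of \<open>B\<close> reached by the first word is moved by an automorphism to the copy from which the
  second word starts.
\<close>

lemma reach_trans:
  assumes "finite S" "reach f S A B" "reach f S B C"
  shows "reach f S A C"
proof -
  obtain g x where g: "g \<in> words E f" "realizes x S A" "realizes (g \<circ> x) S B"
    using assms(2) unfolding reach_def by blast
  obtain g' y where g': "g' \<in> words E f" "realizes y S B" "realizes (g' \<circ> y) S C"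
    using assms(3) unfolding reach_def by blast
  obtain a where a: "a \<in> automorphisms E" "\<And>i. i \<in> S \<Longrightarrow> a ((g \<circ> x) i) = y i"
    using homogeneity[OF assms(1) g(3) g'(2)] by blast
  have "realizes ((g' \<circ> a \<circ> g) \<circ> x) S C"
    using g'(3) a(2) unfolding realizes_def by (simp add: inj_on_def)
  moreover have "g' \<circ> a \<circ> g \<in> words E f"
    using g g' a by (blast intro: words.intros)
  ultimately show ?thesis using g(2) unfolding reach_def by blast
qed

text \<open>
  To imitate \<open>e\<close> on \<open>S\<close>, compose a word with automorphisms that identify \<open>S\<close> with the copy it acts
  on and the image of that copy with the image of \<open>e\<close>. The larger set \<open>T\<close> makes room for a
  distinguished vertex that \<open>S\<close> may lack.
\<close>

lemma reach_imp_generates: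
  assumes "inj e"
    and "\<And>S. finite S \<Longrightarrow> \<exists>T. finite T \<and> S \<subseteq> T \<and> reach f T adj (\<lambda>i j. adj (e i) (e j))"
  shows "generates E (unary f) (unary e)"
  unfolding generates_unary_iff
proof (intro allI impI)
  fix S :: "'v set" assume "finite S"
  then obtain T where T: "finite T" "S \<subseteq> T" "reach f T adj (\<lambda>i j. adj (e i) (e j))"
    using assms(2) by blast
  then obtain g x where g: "g \<in> words E f" "realizes x T adj"
    "realizes (g \<circ> x) T (\<lambda>i j. adj (e i) (e j))"
    unfolding reach_def by blast
  have "realizes id T adj" by (simp add: realizes_def)
  from homogeneity[OF T(1) this g(2)] obtain a where
    a: "a \<in> automorphisms E" "\<And>i. i \<in> T \<Longrightarrow> a i = x i" by auto
  have "realizes e T (\<lambda>i j. adj (e i) (e j))"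
    using assms(1) by (intro realizes_adj) (rule inj_on_subset, auto)
  from homogeneity[OF T(1) g(3) this] obtain b where
    b: "b \<in> automorphisms E" "\<And>i. i \<in> T \<Longrightarrow> b (g (x i)) = e i" by auto
  have "b \<circ> g \<circ> a \<in> words E f" using a b g by (blast intro: words.intros)
  moreover have "\<forall>i\<in>S. e i = (b \<circ> g \<circ> a) i" using a b T(2) by auto
  ultimately show "\<exists>w\<in>words E f. \<forall>x\<in>S. e x = w x" by blast
qed

text \<open>
  Each step lowers the number of pairs of kind \<open>\<not> b\<close>, since the chosen pair is turned into kind
  \<open>b\<close> and no pair of kind \<open>b\<close> is spoilt: \<open>b = True\<close> leads to complete graphs, \<open>b = False\<close> to edgeless ones.
\<close>

lemma reach_constant_by_descent:
  assumes step: "\<And>(S :: 'v set) A s t. finite S \<Longrightarrow> symp A \<Longrightarrow> s \<in> S \<Longrightarrow> t \<in> S \<Longrightarrow> s \<noteq> t \<Longrightarrow>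
      A s t = (\<not> b) \<Longrightarrow> \<exists>g\<in>words E f. \<exists>x. realizes x S A \<and> inj_on (g \<circ> x) S \<and>
        (\<forall>i\<in>S. \<forall>j\<in>S. i \<noteq> j \<longrightarrow> A i j = b \<longrightarrow> adj (g (x i)) (g (x j)) = b) \<and>
        adj (g (x s)) (g (x t)) = b"
    and "finite S" and "symp A"
  shows "reach f S A (\<lambda>_ _. b)"
  using assms(3)
proof (induction "card {(i, j) \<in> S \<times> S. i \<noteq> j \<and> A i j = (\<not> b)}" arbitrary: A rule: less_induct)
  case less
  show ?case
  proof (cases "\<exists>s\<in>S. \<exists>t\<in>S. s \<noteq> t \<and> A s t = (\<not> b)")
    case False
    obtain x where x: "realizes x S A" by (rule realization_exists[OF assms(2) less.prems])
    have "realizes (id \<circ> x) S (\<lambda>_ _. b)"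
      using realizes_cong[OF x, of "\<lambda>_ _. b"] False by auto
    with x show ?thesis unfolding reach_def
      by (blast intro: words_aut[OF id_automorphism])
  next
    case True
    then obtain s t where st: "s \<in> S" "t \<in> S" "s \<noteq> t" "A s t = (\<not> b)" by blast
    obtain g x where g: "g \<in> words E f" "realizes x S A" "inj_on (g \<circ> x) S"
      "\<forall>i\<in>S. \<forall>j\<in>S. i \<noteq> j \<longrightarrow> A i j = b \<longrightarrow> adj (g (x i)) (g (x j)) = b"
      "adj (g (x s)) (g (x t)) = b"
      using step[OF assms(2) less.prems st] by blast
    define B where "B = (\<lambda>i j. adj ((g \<circ> x) i) ((g \<circ> x) j))"
    have "reach f S A B"
      using g(1,2) realizes_adj[OF g(3)] unfolding reach_def B_def by blast
    moreover have "reach f S B (\<lambda>_ _. b)"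
    proof (rule less.hyps)
      show "symp B" by (rule sympI) (simp add: B_def adj_commute)
      have "B s t = b" using g(5) by (simp add: B_def)
      moreover have "B i j = b" if "i \<in> S" "j \<in> S" "i \<noteq> j" "A i j = b" for i j
        using g(4) that by (simp add: B_def)
      ultimately have "{(i, j) \<in> S \<times> S. i \<noteq> j \<and> B i j = (\<not> b)} \<subset>
          {(i, j) \<in> S \<times> S. i \<noteq> j \<and> A i j = (\<not> b)}"
        using st by blast
      then show "card {(i, j) \<in> S \<times> S. i \<noteq> j \<and> B i j = (\<not> b)} <
          card {(i, j) \<in> S \<times> S. i \<noteq> j \<and> A i j = (\<not> b)}"
        by (rule psubset_card_mono[rotated])
          (rule finite_subset[of _ "S \<times> S"], use assms(2) in auto)
    qed
    ultimately show ?thesis using reach_trans[OF assms(2)] by blast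
  qed
qed

section \<open>Rigidity away from the exceptional functions\<close>

text \<open>
  For \<open>h = Not\<close> this is the switch at \<open>s\<close>; for constant \<open>h\<close> the vertex \<open>s\<close> gets joined to all
  others or isolated from them.
\<close>

definition hub :: "(bool \<Rightarrow> bool) \<Rightarrow> 'v \<Rightarrow> ('v \<Rightarrow> 'v \<Rightarrow> bool) \<Rightarrow> 'v \<Rightarrow> 'v \<Rightarrow> bool" where
  "hub h s A i j = (if i = s \<or> j = s then h (A i j) else A i j)"

text \<open>
  In terms of finite graphs, this is what it means that an injective \<open>f\<close> generates none of \<open>e_N\<close>,
  \<open>e_E\<close>, \<open>-\<close> and \<open>sw\<close>: the graphs \<open>A\<close> are witnesses that words in \<open>f\<close> cannot imitate these.
\<close>

definition tame :: "('v \<Rightarrow> 'v) \<Rightarrow> bool" where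
  "tame f \<longleftrightarrow> inj f \<and>
     (\<forall>b. \<exists>S A. finite S \<and> symp A \<and> \<not> reach f S A (\<lambda>_ _. b)) \<and>
     (\<exists>S A. finite S \<and> symp A \<and> \<not> reach f S A (\<lambda>i j. \<not> A i j)) \<and>
     (\<exists>S s A. finite S \<and> s \<in> S \<and> symp A \<and> \<not> reach f S A (hub Not s A))"

lemma bool_fun_cases:
  fixes h :: "bool \<Rightarrow> bool"
  obtains "h = id" | "h = Not" | b where "h = (\<lambda>_. b)"
proof (cases "h True"; cases "h False")
  assume "h True" "h False"
  then have "h = (\<lambda>_. True)" by (metis (full_types))
  then show ?thesis by (rule that(3))
next
  assume "h True" "\<not> h False"
  then have "h = id" by (metis (full_types) id_apply ext)
  then show ?thesis by (rule that(1))
next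
  assume "\<not> h True" "h False"
  then have "h = Not" by (metis (full_types) ext)
  then show ?thesis by (rule that(2))
next
  assume "\<not> h True" "\<not> h False"
  then have "h = (\<lambda>_. False)" by (metis (full_types))
  then show ?thesis by (rule that(3))
qed

lemma reachI:
  assumes "inj f" "realizes x S A"
    "\<forall>i\<in>S. \<forall>j\<in>S. i \<noteq> j \<longrightarrow> adj (f (x i)) (f (x j)) = B i j"
  shows "reach f S A B"
proof -
  have "inj_on x S" using assms(2) unfolding realizes_def by blast
  then have "inj_on (f \<circ> x) S" using assms(1) by (simp add: comp_inj_on inj_on_subset)
  then have "realizes (f \<circ> x) S B" using assms(3) unfolding realizes_def by simp
  then show ?thesis using assms(2) words_gen unfolding reach_def by blast
qed

text \<open>
  A constant \<open>h\<close> makes all pairs at a freely chosen vertex equal to \<open>b\<close>, so it triggers the descent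
  to complete or edgeless graphs; \<open>h = Not\<close> is a switch. Both contradict tameness.
\<close>

lemma tame_not_hub:
  assumes f: "tame f" and h: "h \<noteq> id"
    and hub: "\<And>S s A. finite S \<Longrightarrow> s \<in> S \<Longrightarrow> symp A \<Longrightarrow> reach f S A (hub h s A)"
  shows False
proof (cases h rule: bool_fun_cases)
  case 1
  then show False using h by blast
next
  case 2
  then show False using f hub unfolding tame_def by blast
next
  case (3 b)
  have "reach f S A (\<lambda>_ _. b)" if S: "finite S" "symp A" for S A
  proof (rule reach_constant_by_descent[OF _ S])
    fix S :: "'v set" and A :: "'v \<Rightarrow> 'v \<Rightarrow> bool" and s t
    assume S: "finite S" "symp A" and st: "s \<in> S" "t \<in> S" "s \<noteq> t"
    obtain g x where g: "g \<in> words E f" "realizes x S A" "realizes (g \<circ> x) S (hub h s A)"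
      using hub[OF S(1) st(1) S(2)] unfolding reach_def by blast
    have adj: "adj (g (x i)) (g (x j)) = hub h s A i j" if "i \<in> S" "j \<in> S" "i \<noteq> j" for i j
      using g(3) that unfolding realizes_def by simp
    have "inj_on (g \<circ> x) S" using g(3) unfolding realizes_def by blast
    moreover have "\<forall>i\<in>S. \<forall>j\<in>S. i \<noteq> j \<longrightarrow> A i j = b \<longrightarrow> adj (g (x i)) (g (x j)) = b"
      using adj 3 by (simp add: hub_def)
    moreover have "adj (g (x s)) (g (x t)) = b" using adj[OF st] 3 by (simp add: hub_def)
    ultimately show "\<exists>g\<in>words E f. \<exists>x. realizes x S A \<and> inj_on (g \<circ> x) S \<and>
        (\<forall>i\<in>S. \<forall>j\<in>S. i \<noteq> j \<longrightarrow> A i j = b \<longrightarrow> adj (g (x i)) (g (x j)) = b) \<and>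
        adj (g (x s)) (g (x t)) = b"
      using g(1,2) by blast
  qed
  then show False using f unfolding tame_def by blast
qed

lemma ex_map_eq:
  assumes "distinct xs" "length xs = length ys"
  shows "\<exists>\<phi>. map \<phi> xs = ys"
  using assms(2,1)
proof (induction rule: list_induct2)
  case (Cons x xs y ys)
  then obtain \<phi> where \<phi>: "map \<phi> xs = ys" by auto
  have "map (\<phi>(x := y)) xs = map \<phi> xs" using Cons.prems by auto
  then have "map (\<phi>(x := y)) (x # xs) = y # ys" using \<phi> by simp
  then show ?case by (rule exI[of _ "\<phi>(x := y)"])
qed simp

text \<open>
  Start with many copies of \<open>X\<close>, shrink them until every pair of them has a definite behaviour, and
  apply Ramsey's theorem for pairs and four colours, the four functions \<open>bool \<Rightarrow> bool\<close>.
\<close>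

lemma behaves_uniformly:
  assumes X: "large X"
  shows "\<exists>h. \<forall>js :: 'v list. distinct js \<and> length js \<le> m \<longrightarrow>
    (\<exists>Y. (\<forall>j\<in>set js. large (Y j) \<and> Y j \<subseteq> X) \<and>
         sorted_wrt (\<lambda>i j. behaves f h (Y i) (Y j)) js)"
proof -
  obtain N :: nat where N: "partn_lst {..<N} [m, m, m, m] 2"
    using ramsey_full by blast
  have "\<exists>Y. (\<forall>i\<in>set [0..<N]. large (Y i) \<and> Y i \<subseteq> X) \<and>
      sorted_wrt (\<lambda>i j. \<exists>h. behaves f h (Y i) (Y j)) [0..<N]"
  proof (rule shrink_pairwise[where X = "\<lambda>_. X"])
    fix X Y assume "large X" "large Y"
    from behaves_exists[OF this, of f]
    show "\<exists>X'\<subseteq>X. \<exists>Y'\<subseteq>Y. large X' \<and> large Y' \<and> (\<exists>h. behaves f h X' Y')" by metis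
  next
    fix X Y X' Y' assume "\<exists>h. behaves f h X Y" and sub: "X' \<subseteq> X" "Y' \<subseteq> Y"
    then obtain h where "behaves f h X Y" by blast
    from behaves_subset[OF this sub] show "\<exists>h. behaves f h X' Y'" by blast
  qed (use X in auto)
  then obtain Y where Y: "\<forall>i\<in>set [0..<N]. large (Y i) \<and> Y i \<subseteq> X"
    "sorted_wrt (\<lambda>i j. \<exists>h. behaves f h (Y i) (Y j)) [0..<N]"
    by (elim exE conjE)
  have "\<exists>h. behaves f h (Y i) (Y j)" if "i < j" "j < N" for i j
    using Y(2) that by (simp add: sorted_wrt_iff_nth_less)
  then obtain \<eta> where \<eta>: "\<And>i j. i < j \<Longrightarrow> j < N \<Longrightarrow> behaves f (\<eta> i j) (Y i) (Y j)" by metis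
  \<comment> \<open>The colours have to be numbers below \<open>4\<close>, so the four functions are encoded in binary.\<close>
  define code :: "(bool \<Rightarrow> bool) \<Rightarrow> nat" where "code h = of_bool (h True) + 2 * of_bool (h False)" for h
  have decode: "h = (\<lambda>b. if b then odd (code h) else code h \<ge> 2)" for h
    by (auto simp: code_def fun_eq_iff)
  \<comment> \<open>The behaviour is attached to ordered pairs of indices, while Ramsey colours unordered ones;
    \<open>\<eta> i j\<close> is meaningful for \<open>i < j\<close> only.\<close>
  define colour where "colour e = code (\<eta> (Min e) (Max e))" for e
  have "code h < 4" for h by (simp add: code_def)
  then have "colour \<in> nsets {..<N} 2 \<rightarrow> {..<4}" by (simp add: colour_def)
  then obtain k H where "k < length [m, m, m, m]" and H: "H \<in> nsets {..<N} ([m, m, m, m] ! k)"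
    "colour ` nsets H 2 \<subseteq> {k}"
    by (rule partn_lstE[OF N]) simp_all
  then have "[m, m, m, m] ! k = m" by (auto simp: nth_Cons' split: if_splits)
  then have H': "H \<subseteq> {..<N}" "card H = m" "finite H" using H(1) by (auto simp: nsets_def)
  define h where "h = (\<lambda>b. if b then odd k else k \<ge> 2)"
  have uniform: "behaves f h (Y i) (Y j)" if ij: "i \<in> H" "j \<in> H" "i < j" for i j
  proof -
    have "{i, j} \<in> nsets H 2" using ij by simp
    then have "colour {i, j} = k" using H(2) by blast
    moreover have "Min {i, j} = i" "Max {i, j} = j" using ij(3) by simp_all
    ultimately have "code (\<eta> i j) = k" by (simp add: colour_def)
    then have "\<eta> i j = h" using decode[of "\<eta> i j"] unfolding h_def by (simp only:)
    then show ?thesis using \<eta>[of i j] ij H'(1) by auto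
  qed
  show ?thesis
  proof (intro exI[of _ h] allI impI)
    fix js :: "'v list" assume js: "distinct js \<and> length js \<le> m"
    \<comment> \<open>Names from \<open>js\<close> are matched with the first elements of \<open>H\<close> in increasing order, so that
      the order of the list is the order of the indices.\<close>
    define hs where "hs = take (length js) (sorted_list_of_set H)"
    have "length js = length hs" using js H' by (simp add: hs_def)
    with js obtain \<phi> where \<phi>: "map \<phi> js = hs" using ex_map_eq by blast
    have hs: "set hs \<subseteq> H" using set_take_subset[of _ "sorted_list_of_set H"] H'(3)
      by (auto simp: hs_def)
    have "sorted_wrt (<) hs" unfolding hs_def by (intro sorted_wrt_take) simp
    then have "sorted_wrt (\<lambda>i j. behaves f h (Y i) (Y j)) hs"
      by (rule sorted_wrt_mono_rel[rotated]) (use hs uniform in blast)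
    then have "sorted_wrt (\<lambda>i j. behaves f h (Y (\<phi> i)) (Y (\<phi> j))) js"
      unfolding \<phi>[symmetric] by (simp add: sorted_wrt_map)
    moreover have "large (Y (\<phi> j)) \<and> Y (\<phi> j) \<subseteq> X" if "j \<in> set js" for j
    proof -
      have "\<phi> j \<in> set hs" using that unfolding \<phi>[symmetric] by simp
      then have "\<phi> j < N" using hs H'(1) by blast
      then show ?thesis using Y(1) by simp
    qed
    ultimately show "\<exists>Y. (\<forall>j\<in>set js. large (Y j) \<and> Y j \<subseteq> X) \<and>
         sorted_wrt (\<lambda>i j. behaves f h (Y i) (Y j)) js"
      by (intro exI[of _ "\<lambda>j. Y (\<phi> j)"]) simp
  qed
qed

text \<open>
  Any uniform behaviour other than \<open>id\<close>, on sufficiently many large sets, would transform one of the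
  graphs that witness tameness in a forbidden way.
\<close>

lemma tame_preserving_copies:
  assumes f: "tame f" and X: "large X" and "distinct (is :: 'v list)"
  shows "\<exists>Y. (\<forall>i\<in>set is. large (Y i) \<and> Y i \<subseteq> X) \<and>
         sorted_wrt (\<lambda>i j. behaves f id (Y i) (Y j)) is"
proof -
  have "inj f" using f unfolding tame_def by blast
  obtain S A where SA: "\<And>b. finite (S b) \<and> symp (A b) \<and> \<not> reach f (S b) (A b) (\<lambda>_ _. b)"
    using f unfolding tame_def by metis
  obtain S' A' where SA': "finite S'" "symp A'" "\<not> reach f S' A' (\<lambda>i j. \<not> A' i j)"
    using f unfolding tame_def by blast
  \<comment> \<open>Enough sets for the given list and for each of the three witnesses of tameness.\<close>
  define m where "m = length is + card (S True) + card (S False) + card S'"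
  from behaves_uniformly[OF X, of m f] obtain h where
    h: "\<And>js :: 'v list. distinct js \<Longrightarrow> length js \<le> m \<Longrightarrow>
      \<exists>Y. (\<forall>j\<in>set js. large (Y j) \<and> Y j \<subseteq> X) \<and>
         sorted_wrt (\<lambda>i j. behaves f h (Y i) (Y j)) js" by blast
  have reach: "reach f T B (\<lambda>i j. h (B i j))" if T: "finite T" "card T \<le> m" "symp B" for T B
  proof -
    obtain js where js: "set js = T" "distinct js" using finite_distinct_list[OF T(1)] by blast
    then have "length js \<le> m" using T(2) distinct_card by fastforce
    from h[OF js(2) this] obtain Y where
      Y: "\<forall>j\<in>set js. large (Y j) \<and> Y j \<subseteq> X" "sorted_wrt (\<lambda>i j. behaves f h (Y i) (Y j)) js"
      by (elim exE conjE)
    have "\<forall>j\<in>set js. large (Y j)" using Y(1) by blast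
    from realization_by_selection[OF js(2) this, where H = "\<lambda>_ _. h" and f = f and A = B, OF Y(2) refl T(3)]
    obtain x where "realizes x T B"
      "\<forall>i\<in>T. \<forall>j\<in>T. i \<noteq> j \<longrightarrow> adj (f (x i)) (f (x j)) = h (B i j)" unfolding js(1) by blast
    then show ?thesis by (rule reachI[OF \<open>inj f\<close>])
  qed
  have "h = id"
  proof (cases h rule: bool_fun_cases)
    case 2
    have "reach f S' A' (\<lambda>i j. h (A' i j))" by (rule reach) (use SA' in \<open>auto simp: m_def\<close>)
    then show ?thesis using 2 SA'(3) by simp
  next
    case (3 b)
    have "reach f (S b) (A b) (\<lambda>i j. h (A b i j))"
      by (rule reach) (use SA[of b] in \<open>cases b; auto simp: m_def\<close>)+
    then show ?thesis using 3 SA[of b] by simp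
  qed
  then show ?thesis using h[OF assms(3)] by (simp add: m_def)
qed

text \<open>
  Let \<open>h\<close> be the behaviour between the two sets. One vertex in the first set and many vertices in
  the second, arranged so that \<open>f\<close> preserves the pairs among the latter, show that words carry any
  finite graph to its image under \<open>hub h s\<close>. So \<open>h\<close> must be \<open>id\<close>.
\<close>

lemma tame_preserving_pair:
  assumes f: "tame f" and X: "large X" and Y: "large Y"
  shows "\<exists>X'\<subseteq>X. \<exists>Y'\<subseteq>Y. large X' \<and> large Y' \<and> behaves f id X' Y'"
proof -
  have "inj f" using f unfolding tame_def by blast
  obtain X1 Y1 h where 1: "X1 \<subseteq> X" "Y1 \<subseteq> Y" "large X1" "large Y1" "behaves f h X1 Y1"
    by (rule behaves_exists[OF X Y])
  have "h = id"
  proof (rule ccontr)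
    assume "h \<noteq> id"
    then show False
    proof (rule tame_not_hub[OF f])
      fix S :: "'v set" and s and A :: "'v \<Rightarrow> 'v \<Rightarrow> bool" assume S: "finite S" "s \<in> S" "symp A"
      obtain js where js: "set js = S - {s}" "distinct js"
        using finite_distinct_list[of "S - {s}"] S(1) by blast
      from tame_preserving_copies[OF f 1(4) js(2)] obtain Z where
        Z: "\<forall>i\<in>set js. large (Z i) \<and> Z i \<subseteq> Y1" "sorted_wrt (\<lambda>i j. behaves f id (Z i) (Z j)) js"
        by (elim exE conjE)
      define W where "W = Z(s := X1)"
      define H where "H i j = (if i = s \<or> j = s then h else id)" for i j
      have set_js: "set (s # js) = S" and "distinct (s # js)" using js S(2) by auto
      have W: "\<forall>i\<in>set (s # js). large (W i)" using Z(1) 1(3) by (simp add: W_def)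
      have "sorted_wrt (\<lambda>i j. behaves f (H i j) (W i) (W j)) js"
        by (rule sorted_wrt_mono_rel[OF _ Z(2)]) (use js in \<open>auto simp: H_def W_def\<close>)
      moreover have "behaves f (H s j) (W s) (W j)" if "j \<in> set js" for j
      proof -
        have "W s = X1" "W j = Z j" "H s j = h" using that js by (auto simp: W_def H_def)
        then show ?thesis using behaves_subset[OF 1(5) subset_refl, of "Z j"] Z(1) that by simp
      qed
      ultimately have "sorted_wrt (\<lambda>i j. behaves f (H i j) (W i) (W j)) (s # js)" by simp
      moreover have "H i j = H j i" for i j by (auto simp: H_def)
      ultimately obtain x where "realizes x S A"
        "\<forall>i\<in>S. \<forall>j\<in>S. i \<noteq> j \<longrightarrow> adj (f (x i)) (f (x j)) = H i j (A i j)"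
        using realization_by_selection[where X = W and H = H and f = f and A = A,
            OF \<open>distinct (s # js)\<close> W _ _ S(3)]
        unfolding set_js by blast
      then show "reach f S A (hub h s A)"
        by (intro reachI[OF \<open>inj f\<close>]) (auto simp: H_def hub_def)
    qed
  qed
  then show ?thesis using 1 by blast
qed

text \<open>
  Otherwise there is a large set of vertices \<open>y\<close> with \<open>adj c y = b\<close> whose pair with \<open>c\<close> changes to
  \<open>\<not> b\<close>. Among the \<open>y\<close> with \<open>adj c y = (\<not> b)\<close>, some outcome \<open>v\<close> for the pair with \<open>c\<close> also
  occurs on a large set. Placing \<open>c\<close> at \<open>s\<close> and all other vertices in these two sets, with \<open>f\<close>
  preserving the pairs among them, realises \<open>hub h s\<close> for the function \<open>h\<close> with \<open>h b = (\<not> b)\<close> and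
  \<open>h (\<not> b) = v\<close>, which is not \<open>id\<close>.
\<close>

lemma tame_bad_thin:
  assumes f: "tame f"
  shows "\<not> large {y. c \<noteq> y \<and> adj (f c) (f y) \<noteq> adj c y}"
proof
  assume bad: "large {y. c \<noteq> y \<and> adj (f c) (f y) \<noteq> adj c y}"
  have "inj f" using f unfolding tame_def by blast
  have "\<exists>b. large {y \<in> {y. c \<noteq> y \<and> adj (f c) (f y) \<noteq> adj c y}. adj c y = b}"
    using large_split[OF bad, of "adj c"] unfolding ex_bool_eq by simp
  then obtain b where "large {y \<in> {y. c \<noteq> y \<and> adj (f c) (f y) \<noteq> adj c y}. adj c y = b}" ..
  then have Xb: "large {y. c \<noteq> y \<and> adj c y = b \<and> adj (f c) (f y) = (\<not> b)}" (is "large ?Xb")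
    by (rule large_mono) auto
  have "large {y. y \<notin> {c} \<and> (\<forall>u\<in>{c}. adj y u \<longleftrightarrow> \<not> b)}" by (rule large_type) simp
  then have "large {y. c \<noteq> y \<and> adj c y = (\<not> b)}"
    by (rule large_mono) (use adj_commute in auto)
  from large_split[OF this, of "\<lambda>y. adj (f c) (f y)"]
  have "\<exists>v. large {y \<in> {y. c \<noteq> y \<and> adj c y = (\<not> b)}. adj (f c) (f y) = v}"
    unfolding ex_bool_eq by simp
  then obtain v where "large {y \<in> {y. c \<noteq> y \<and> adj c y = (\<not> b)}. adj (f c) (f y) = v}" ..
  then have Y: "large {y. c \<noteq> y \<and> adj c y = (\<not> b) \<and> adj (f c) (f y) = v}" (is "large ?Y")
    by (rule large_mono) auto
  define h where "h = (\<lambda>a. if a = b then \<not> b else v)"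
  have "h b \<noteq> id b" by (simp add: h_def)
  then have "h \<noteq> id" by auto
  then show False
  proof (rule tame_not_hub[OF f])
    fix S :: "'v set" and s and A :: "'v \<Rightarrow> 'v \<Rightarrow> bool" assume S: "finite S" "s \<in> S" "symp A"
    obtain js where js: "set js = S - {s}" "distinct js"
      using finite_distinct_list[of "S - {s}"] S(1) by blast
    define X where "X i = (if A s i = b then ?Xb else ?Y)" for i
    have X: "\<forall>i\<in>set js. large (X i)" using Xb Y by (simp add: X_def)
    have "\<exists>Z. (\<forall>i\<in>set js. large (Z i) \<and> Z i \<subseteq> X i) \<and>
        sorted_wrt (\<lambda>i j. behaves f id (Z i) (Z j)) js"
      by (rule shrink_pairwise[OF tame_preserving_pair[OF f] behaves_subset js(2) X])
    then obtain Z where Z: "\<forall>i\<in>set js. large (Z i) \<and> Z i \<subseteq> X i"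
      "sorted_wrt (\<lambda>i j. behaves f id (Z i) (Z j)) js" by (elim exE conjE)
    have "\<forall>i\<in>set js. large (Z i)" using Z(1) by blast
    from realization_by_selection[OF js(2) this, where H = "\<lambda>_ _. id" and f = f and A = A, OF Z(2) refl S(3)]
    obtain y where y: "\<forall>i\<in>S - {s}. y i \<in> Z i" "realizes y (S - {s}) A"
      "\<forall>i\<in>S - {s}. \<forall>j\<in>S - {s}. i \<noteq> j \<longrightarrow> adj (f (y i)) (f (y j)) = A i j"
      unfolding js(1) by auto
    define x where "x = y(s := c)"
    define G where "G i j \<longleftrightarrow> x i \<noteq> x j \<and> adj (x i) (x j) = A i j \<and>
      adj (f (x i)) (f (x j)) = hub h s A i j" for i j
    have sym: "G j i" if "G i j" for i j
    proof -
      have "A i j = A j i" using sympD[OF S(3)] by blast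
      then show ?thesis
        using that adj_commute[of "x i" "x j"] adj_commute[of "f (x i)" "f (x j)"]
        unfolding G_def hub_def by auto
    qed
    have outer: "G s j" if j: "j \<in> S - {s}" for j
    proof -
      have "y j \<in> X j" using y(1) Z(1) j unfolding js(1) by blast
      then have "c \<noteq> y j \<and> adj c (y j) = A s j \<and> adj (f c) (f (y j)) = h (A s j)"
        unfolding X_def h_def by (auto split: if_splits)
      then show ?thesis using j unfolding G_def x_def hub_def by auto
    qed
    have inner: "G i j" if ij: "i \<in> S - {s}" "j \<in> S - {s}" "i \<noteq> j" for i j
    proof -
      have "y i \<noteq> y j" using y(2) ij unfolding realizes_def inj_on_def by blast
      moreover have "adj (y i) (y j) = A i j" using y(2) ij unfolding realizes_def by blast
      moreover have "adj (f (y i)) (f (y j)) = A i j" using y(3) ij by blast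
      ultimately show ?thesis using ij unfolding G_def x_def hub_def by auto
    qed
    have G: "G i j" if "i \<in> S" "j \<in> S" "i \<noteq> j" for i j
      using that outer[of i] outer[of j] sym[of s i] inner[of i j] by auto
    have "realizes x S A" using G unfolding realizes_def inj_on_def G_def by blast
    then show "reach f S A (hub h s A)"
      by (rule reachI[OF \<open>inj f\<close>]) (use G in \<open>auto simp: G_def\<close>)
  qed
qed

text \<open>
  A single changed pair \<open>{c, d}\<close> can be used as a tool: copies of finite graphs are routed through
  \<open>c\<close> and \<open>d\<close> with all other pairs preserved, so \<open>f\<close> alters exactly one chosen pair, and the descent
  to a complete or an edgeless graph contradicts tameness.
\<close>

lemma tame_preserves_adj:
  assumes f: "tame f"
  shows "adj (f c) (f d) = adj c d"
proof (rule ccontr)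
  assume neq: "adj (f c) (f d) \<noteq> adj c d"
  have "inj f" using f unfolding tame_def by blast
  have "c \<noteq> d" using neq by (auto simp: not_adj_self)
  define b where "b = adj (f c) (f d)"
  have b: "adj c d = (\<not> b)" "adj (f c) (f d) = b" using neq by (auto simp: b_def)
  have "symp (\<lambda>x y. adj (f x) (f y) = adj x y)" by (rule sympI) (simp add: adj_commute)
  note pair = realization_through_pair[where P = "\<lambda>x y. adj (f x) (f y) = adj x y",
    OF tame_bad_thin[OF f] this]
  have "reach f S A (\<lambda>_ _. b)" if S: "finite S" "symp A" for S A
  proof (rule reach_constant_by_descent[OF _ S])
    fix S :: "'v set" and A :: "'v \<Rightarrow> 'v \<Rightarrow> bool" and s t
    assume S: "finite S" "symp A" and st: "s \<in> S" "t \<in> S" "s \<noteq> t" and A: "A s t = (\<not> b)"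
    have "adj c d = A s t" using A b by simp
    from pair[OF S(2,1) st \<open>c \<noteq> d\<close> this] obtain x where
      x: "realizes x S A" "x s = c" "x t = d"
        "\<forall>i\<in>S. \<forall>j\<in>S. i \<noteq> j \<longrightarrow> {i, j} \<noteq> {s, t} \<longrightarrow>
           adj (f (x i)) (f (x j)) = adj (x i) (x j)" by (elim exE conjE)
    have "inj_on x S" using x(1) unfolding realizes_def by blast
    then have "inj_on (f \<circ> x) S" using \<open>inj f\<close> by (simp add: comp_inj_on inj_on_subset)
    moreover have "adj (f (x i)) (f (x j)) = b" if ij: "i \<in> S" "j \<in> S" "i \<noteq> j" "A i j = b" for i j
    proof -
      have "A t s = (\<not> b)" using A sympD[OF S(2)] by blast
      then have "{i, j} \<noteq> {s, t}" using A ij(4) by (auto simp: doubleton_eq_iff)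
      moreover have "adj (x i) (x j) = A i j" using x(1) ij unfolding realizes_def by blast
      ultimately show ?thesis using x(4) ij by simp
    qed
    moreover have "adj (f (x s)) (f (x t)) = b" using x(2,3) b by simp
    ultimately show "\<exists>g\<in>words E f. \<exists>x. realizes x S A \<and> inj_on (g \<circ> x) S \<and>
        (\<forall>i\<in>S. \<forall>j\<in>S. i \<noteq> j \<longrightarrow> A i j = b \<longrightarrow> adj (g (x i)) (g (x j)) = b) \<and>
        adj (g (x s)) (g (x t)) = b"
      using x(1) by (intro bexI[OF _ words_gen] exI[of _ x]) simp
  qed
  then show False using f unfolding tame_def by blast
qed

section \<open>Non-injective functions\<close>

text \<open>
  Words that collapse an edge and words that collapse a non-edge can, by homogeneity, be made to
  collapse any given pair, so a finite set shrinks to a point, which an automorphism moves to \<open>z\<close>.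
\<close>

lemma generates_constant:
  assumes collapse: "\<And>b. \<exists>g\<in>words E f. \<exists>x y. x \<noteq> y \<and> adj x y = b \<and> g x = g y"
  shows "generates E (unary f) (unary (\<lambda>_. z))"
proof -
  have pair: "\<exists>g\<in>words E f. g p = g q" if pq: "p \<noteq> q" for p q
  proof -
    obtain g x y where g: "g \<in> words E f" "x \<noteq> y" "adj x y = adj p q" "g x = g y"
      using collapse by blast
    obtain a where a: "a \<in> automorphisms E" "a p = x" "a q = y"
      by (rule homogeneity_pair[of p q x y]) (use pq g in auto)
    have "g \<circ> a \<in> words E f" using a g by (blast intro: words.intros)
    moreover have "(g \<circ> a) p = (g \<circ> a) q" using a g by simp
    ultimately show ?thesis by blast
  qed
  have "\<exists>w\<in>words E f. \<forall>x\<in>S. w x = z" if "finite S" for S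
    using that
  proof (induction S)
    case empty
    show ?case using words_gen by blast
  next
    case (insert x S)
    then obtain w where w: "w \<in> words E f" "\<forall>y\<in>S. w y = z" by blast
    show ?case
    proof (cases "w x = z")
      case True
      then show ?thesis using w by blast
    next
      case False
      then obtain g where g: "g \<in> words E f" "g (w x) = g z" using pair by blast
      obtain a where a: "a \<in> automorphisms E" "a (g z) = z" by (rule homogeneity_point)
      have "a \<circ> g \<circ> w \<in> words E f" using a g w by (blast intro: words.intros)
      then show ?thesis using a g w by (intro bexI[of _ "a \<circ> g \<circ> w"]) auto
    qed
  qed
  then show ?thesis unfolding generates_unary_iff by metis
qed

text \<open>
  Let \<open>f\<close> collapse \<open>{c, d}\<close>, a pair of kind \<open>\<not> b\<close>, and suppose that no word collapses a pair of
  kind \<open>b\<close>. Then pairs of kind \<open>b\<close> keep their kind, since otherwise a further application of \<open>f\<close>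
  could collapse them. A vertex \<open>v\<close> with pairs of different kinds to \<open>c\<close> and to \<open>d\<close> must send both
  of them to the same pair, which is of kind \<open>b\<close>; thus \<open>{v, c}\<close> is a pair of kind \<open>\<not> b\<close> that turns
  into kind \<open>b\<close>, and the descent starts.
\<close>

lemma not_inj_dichotomy:
  assumes "\<not> inj f"
  shows "(\<forall>z. generates E (unary f) (unary (\<lambda>_. z))) \<or>
    (\<exists>b. \<forall>S A. finite S \<longrightarrow> symp A \<longrightarrow> reach f S A (\<lambda>_ _. b))"
proof -
  obtain c d where cd: "c \<noteq> d" "f c = f d" using assms by (auto simp: inj_def)
  define b where "b = (\<not> adj c d)"
  have b: "adj c d = (\<not> b)" by (simp add: b_def)
  show ?thesis
  proof (cases "\<exists>g\<in>words E f. \<exists>x y. x \<noteq> y \<and> adj x y = b \<and> g x = g y")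
    case True
    then have "\<exists>g\<in>words E f. \<exists>x y. x \<noteq> y \<and> adj x y = b' \<and> g x = g y" for b'
      using cd b words_gen by (cases "b' = b") blast+
    then show ?thesis using generates_constant by blast
  next
    case False
    then have nc: "g x \<noteq> g y" if "g \<in> words E f" "x \<noteq> y" "adj x y = b" for g x y
      using that by blast
    have keep: "adj (f x) (f y) = b" if xy: "x \<noteq> y" "adj x y = b" for x y
    proof (rule ccontr)
      assume "adj (f x) (f y) \<noteq> b"
      moreover have "f x \<noteq> f y" using nc[OF words_gen xy] .
      ultimately obtain a where a: "a \<in> automorphisms E" "a (f x) = c" "a (f y) = d"
        using homogeneity_pair[of "f x" "f y" c d] cd b by auto
      have "f \<circ> a \<circ> f \<in> words E f" using a by (blast intro: words.intros)
      from nc[OF this xy] show False using a cd by simp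
    qed
    \<comment> \<open>A fibre of \<open>f\<close> contains no pair of kind \<open>b\<close>, whereas a large set contains pairs of both
      kinds; so copies on which \<open>f\<close> is injective are available.\<close>
    have thin: "\<not> large {y. x \<noteq> y \<and> \<not> f x \<noteq> f y}" for x
    proof
      assume "large {y. x \<noteq> y \<and> \<not> f x \<noteq> f y}"
      then obtain y y' where "f x = f y" "f x = f y'" "y \<noteq> y'" "adj y y' = b"
        by (rule large_adj_pair[where b = b]) blast
      then show False using nc[OF words_gen, of y y'] by simp
    qed
    obtain v where v: "v \<notin> {c, d}" "\<And>u. u \<in> {c, d} \<Longrightarrow> adj v u = (if u = c then \<not> b else b)"
      by (rule extension[of "{c, d}" "\<lambda>u. if u = c then \<not> b else b"]) auto
    have vc: "v \<noteq> c" "adj v c = (\<not> b)" and vd: "v \<noteq> d" "adj v d = b"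
      using v(1) v(2)[of c] v(2)[of d] cd(1) by auto
    have fv: "f v \<noteq> f c" "adj (f v) (f c) = b"
      using nc[OF words_gen vd] keep[OF vd] cd(2) by simp_all
    have "reach f S A (\<lambda>_ _. b)" if S: "finite S" "symp A" for S A
    proof (rule reach_constant_by_descent[OF _ S])
      fix S :: "'v set" and A :: "'v \<Rightarrow> 'v \<Rightarrow> bool" and s t
      assume S: "finite S" "symp A" and st: "s \<in> S" "t \<in> S" "s \<noteq> t" and A: "A s t = (\<not> b)"
      have "symp (\<lambda>x y. f x \<noteq> f y)" by (rule sympI) simp
      moreover have "adj v c = A s t" using vc A by simp
      ultimately obtain x where x: "realizes x S A" "x s = v" "x t = c"
        "\<forall>i\<in>S. \<forall>j\<in>S. i \<noteq> j \<longrightarrow> {i, j} \<noteq> {s, t} \<longrightarrow> f (x i) \<noteq> f (x j)"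
        using realization_through_pair[where P = "\<lambda>x y. f x \<noteq> f y", OF thin _ S(2,1) st vc(1)]
        by blast
      have "f (x i) \<noteq> f (x j)" if "i \<in> S" "j \<in> S" "i \<noteq> j" for i j
      proof (cases "{i, j} = {s, t}")
        case True
        then show ?thesis using x(2,3) fv(1) by (auto simp: doubleton_eq_iff)
      qed (use x(4) that in blast)
      then have "inj_on (f \<circ> x) S" by (auto simp: inj_on_def)
      moreover have "adj (f (x i)) (f (x j)) = b" if ij: "i \<in> S" "j \<in> S" "i \<noteq> j" "A i j = b" for i j
      proof (rule keep)
        show "x i \<noteq> x j" using x(1) ij unfolding realizes_def inj_on_def by blast
        show "adj (x i) (x j) = b" using x(1) ij unfolding realizes_def by blast
      qed
      moreover have "adj (f (x s)) (f (x t)) = b" using x(2,3) fv(2) by simp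
      ultimately show "\<exists>g\<in>words E f. \<exists>x. realizes x S A \<and> inj_on (g \<circ> x) S \<and>
          (\<forall>i\<in>S. \<forall>j\<in>S. i \<noteq> j \<longrightarrow> A i j = b \<longrightarrow> adj (g (x i)) (g (x j)) = b) \<and>
          adj (g (x s)) (g (x t)) = b"
        using x(1) by (intro bexI[OF _ words_gen] exI[of _ x]) simp
    qed
    then show ?thesis by blast
  qed
qed

section \<open>The five functions\<close>

lemma words_id:
  assumes "w \<in> words E id"
  shows "w \<in> automorphisms E"
  using assms
proof induction
  case words_gen
  show ?case by (rule id_automorphism)
next
  case (words_comp g h)
  then show ?case using bij_comp[of h g] by (simp add: automorphisms_def comp_def)
qed

text \<open>
  Words in the identity are automorphisms, and self-embeddings agree with automorphisms on finite
  sets by homogeneity.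
\<close>

lemma trivial_unary_iff:
  "trivial E (unary g) \<longleftrightarrow> inj g \<and> (\<forall>x y. adj (g x) (g y) = adj x y)"
proof
  assume "trivial E (unary g)"
  then have "generates E (unary id) (unary g)" by (simp add: trivial_def equivalent_def)
  note gen = generates_unaryD[OF this]
  have "(x \<noteq> y \<longrightarrow> g x \<noteq> g y) \<and> adj (g x) (g y) = adj x y" for x y
  proof -
    have "finite {x, y}" by simp
    from gen[OF this] obtain w where "w \<in> words E id" "\<forall>u\<in>{x, y}. g u = w u" by (elim bexE)
    then have "bij w" "adj (w x) (w y) = adj x y" "g x = w x" "g y = w y"
      using words_id[of w] by (simp_all add: automorphisms_def)
    then show ?thesis by (simp add: bij_def inj_eq)
  qed
  then show "inj g \<and> (\<forall>x y. adj (g x) (g y) = adj x y)" unfolding inj_def by blast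
next
  assume g: "inj g \<and> (\<forall>x y. adj (g x) (g y) = adj x y)"
  have "\<forall>S. finite S \<longrightarrow> (\<exists>w\<in>words E id. \<forall>x\<in>S. g x = w x)"
  proof (intro allI impI)
    fix S :: "'v set" assume "finite S"
    have "inj_on g S" using g by (blast intro: inj_on_subset)
    then have "realizes id S adj" "realizes g S adj"
      using g by (simp_all add: realizes_def)
    from homogeneity[OF \<open>finite S\<close> this] obtain a where "a \<in> automorphisms E" "\<And>i. i \<in> S \<Longrightarrow> a i = g i"
      by auto
    then show "\<exists>w\<in>words E id. \<forall>x\<in>S. g x = w x"
      by (intro bexI[of _ a]) (simp_all add: words_aut)
  qed
  then have "generates E (unary id) (unary g)" unfolding generates_unary_iff .
  moreover have "generates E (unary g) (unary id)"
    unfolding generates_unary_iff using words_aut[OF id_automorphism] by blast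
  ultimately show "trivial E (unary g)" unfolding trivial_def equivalent_def by blast
qed

lemma reach_cong:
  assumes "reach f S A B" "\<And>i j. i \<in> S \<Longrightarrow> j \<in> S \<Longrightarrow> i \<noteq> j \<Longrightarrow> B i j = C i j"
  shows "reach f S A C"
proof -
  obtain g x where g: "g \<in> words E f" "realizes x S A" "realizes (g \<circ> x) S B"
    using assms(1) unfolding reach_def by blast
  from realizes_cong[OF g(3) assms(2)] g(1,2) show ?thesis unfolding reach_def by blast
qed

lemma symp_adj: "symp adj"
  by (rule sympI) (simp add: adj_commute)

lemma generates_of_reach_constant:
  assumes "\<forall>S A. finite S \<longrightarrow> symp A \<longrightarrow> reach f S A (\<lambda>_ _. b)"
    and "inj e" "\<And>i j. i \<noteq> j \<Longrightarrow> adj (e i) (e j) = b"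
  shows "generates E (unary f) (unary e)"
proof (rule reach_imp_generates[OF assms(2)])
  fix S :: "'v set" assume "finite S"
  then have "reach f S adj (\<lambda>_ _. b)" using assms(1) symp_adj by simp
  then have "reach f S adj (\<lambda>i j. adj (e i) (e j))" by (rule reach_cong) (simp add: assms(3))
  then show "\<exists>T. finite T \<and> S \<subseteq> T \<and> reach f T adj (\<lambda>i j. adj (e i) (e j))"
    using \<open>finite S\<close> by (intro exI[of _ S]) simp
qed

lemma is_e_N_imp: "is_e_N E e \<Longrightarrow> inj e \<and> (\<forall>x y. x \<noteq> y \<longrightarrow> adj (e x) (e y) = False)"
  by (simp add: is_e_N_def)

lemma is_e_E_imp: "is_e_E E e \<Longrightarrow> inj e \<and> (\<forall>x y. x \<noteq> y \<longrightarrow> adj (e x) (e y) = True)"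
  by (simp add: is_e_E_def inj_eq)

lemma is_minus_iff: "is_minus E m \<longleftrightarrow> bij m \<and> (\<forall>x y. x \<noteq> y \<longrightarrow> adj (m x) (m y) = (\<not> adj x y))"
  unfolding is_minus_def non_edges_def by auto

lemma is_switch_imp_hub:
  assumes "is_switch E z s" "x \<noteq> y"
  shows "adj (s x) (s y) = hub Not z adj x y"
  using assms adj_commute[of "s z" "s y"] adj_commute[of z y]
  unfolding is_switch_def non_edges_def hub_def by auto

text \<open>
  If \<open>f\<close> generated none of the five it would be injective and tame, hence a self-embedding.
\<close>

lemma generates_one_of_five:
  assumes f: "\<not> trivial E (unary f)"
    and e: "is_e_N E e_N" "is_e_E E e_E" and m: "is_minus E m" and s: "is_switch E z s"
  shows "(\<forall>c. generates E (unary f) (unary (\<lambda>_. c))) \<or>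
    generates E (unary f) (unary e_N) \<or> generates E (unary f) (unary e_E) \<or>
    generates E (unary f) (unary m) \<or> generates E (unary f) (unary s)"
proof (rule ccontr)
  assume none: "\<not> ?thesis"
  have const: "\<not> (\<forall>S A. finite S \<longrightarrow> symp A \<longrightarrow> reach f S A (\<lambda>_ _. b))" for b
  proof
    assume all: "\<forall>S A. finite S \<longrightarrow> symp A \<longrightarrow> reach f S A (\<lambda>_ _. b)"
    define e where "e = (if b then e_E else e_N)"
    have "generates E (unary f) (unary e)"
    proof (rule generates_of_reach_constant[OF all])
      show "inj e" using e(1,2) by (simp add: e_def is_e_N_imp is_e_E_imp)
      show "adj (e i) (e j) = b" if "i \<noteq> j" for i j
        using e(1,2) that by (cases b) (simp_all add: e_def is_e_N_imp is_e_E_imp)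
    qed
    then show False using none by (cases b) (simp_all add: e_def)
  qed
  have "inj f"
  proof (rule ccontr)
    assume "\<not> inj f"
    from not_inj_dichotomy[OF this] show False
    proof (elim disjE exE)
      fix b assume "\<forall>S A. finite S \<longrightarrow> symp A \<longrightarrow> reach f S A (\<lambda>_ _. b)"
      with const show False by (rule notE)
    qed (use none in simp)
  qed
  moreover have "\<exists>S A. finite S \<and> symp A \<and> \<not> reach f S A (\<lambda>i j. \<not> A i j)"
  proof (rule ccontr)
    assume "\<not> ?thesis"
    then have *: "reach f S A (\<lambda>i j. \<not> A i j)" if "finite S" "symp A" for S A
      using that by auto
    have "generates E (unary f) (unary m)"
    proof (rule reach_imp_generates)
      fix S :: "'v set" assume "finite S"
      then have "reach f S adj (\<lambda>i j. \<not> adj i j)" by (rule *[OF _ symp_adj])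
      then have "reach f S adj (\<lambda>i j. adj (m i) (m j))"
        by (rule reach_cong) (use m in \<open>simp add: is_minus_iff\<close>)
      then show "\<exists>T. finite T \<and> S \<subseteq> T \<and> reach f T adj (\<lambda>i j. adj (m i) (m j))"
        using \<open>finite S\<close> by (intro exI[of _ S]) simp
    qed (use m in \<open>simp add: is_minus_def bij_def\<close>)
    then show False using none by blast
  qed
  moreover have "\<exists>S t A. finite S \<and> t \<in> S \<and> symp A \<and> \<not> reach f S A (hub Not t A)"
  proof (rule ccontr)
    assume "\<not> ?thesis"
    then have *: "reach f S A (hub Not t A)" if "finite S" "t \<in> S" "symp A" for S t A
      using that by auto
    have "generates E (unary f) (unary s)"
    proof (rule reach_imp_generates)
      fix S :: "'v set" assume "finite S"
      then have "reach f (insert z S) adj (hub Not z adj)"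
        by (intro *[OF _ _ symp_adj]) simp_all
      then have "reach f (insert z S) adj (\<lambda>i j. adj (s i) (s j))"
        by (rule reach_cong) (simp add: is_switch_imp_hub[OF s])
      then show "\<exists>T. finite T \<and> S \<subseteq> T \<and> reach f T adj (\<lambda>i j. adj (s i) (s j))"
        using \<open>finite S\<close> by (intro exI[of _ "insert z S"]) auto
    qed (use s in \<open>simp add: is_switch_def bij_def\<close>)
    then show False using none by blast
  qed
  moreover have "\<forall>b. \<exists>S A. finite S \<and> symp A \<and> \<not> reach f S A (\<lambda>_ _. b)"
    using const by auto
  ultimately have "tame f" unfolding tame_def by (intro conjI)
  then have "trivial E (unary f)"
    using \<open>inj f\<close> tame_preserves_adj by (simp add: trivial_unary_iff)
  then show False using f by blast
qed

text \<open>
  The invariant that separates \<open>e_N\<close> (with \<open>b = False\<close>) and \<open>e_E\<close> (with \<open>b = True\<close>) from the other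
  injective operations. Requiring distinct images makes it closed under composition.
\<close>

definition preserves :: "bool \<Rightarrow> ('v \<Rightarrow> 'v) \<Rightarrow> bool" where
  "preserves b f \<longleftrightarrow> (\<forall>x y. x \<noteq> y \<longrightarrow> adj x y = b \<longrightarrow> f x \<noteq> f y \<and> adj (f x) (f y) = b)"

lemma automorphism_preserves: "a \<in> automorphisms E \<Longrightarrow> preserves b a"
  by (auto simp: automorphisms_def preserves_def bij_def inj_def)

lemma generated_preserves:
  assumes "preserves b f" "generates E (unary f) (unary g)"
  shows "preserves b g"
proof -
  have word: "preserves b w" if "w \<in> words E f" for w
    using that
  proof induction
    case (words_aut a)
    then show ?case by (rule automorphism_preserves)
  next
    case words_gen
    show ?case by (rule assms(1))
  next
    case (words_comp g h)
    show ?case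
      unfolding preserves_def
    proof (intro allI impI)
      fix x y assume "x \<noteq> y" "adj x y = b"
      then have "h x \<noteq> h y" "adj (h x) (h y) = b"
        using words_comp(4) unfolding preserves_def by blast+
      then have "g (h x) \<noteq> g (h y)" "adj (g (h x)) (g (h y)) = b"
        using words_comp(3) unfolding preserves_def by blast+
      then show "(g \<circ> h) x \<noteq> (g \<circ> h) y \<and> adj ((g \<circ> h) x) ((g \<circ> h) y) = b" by simp
    qed
  qed
  show ?thesis
    unfolding preserves_def
  proof (intro allI impI)
    fix x y assume "x \<noteq> y" "adj x y = b"
    have "finite {x, y}" by simp
    from generates_unaryD[OF assms(2) this] obtain w where
      "w \<in> words E f" "\<forall>u\<in>{x, y}. g u = w u" by (elim bexE)
    moreover from this(1) have "w x \<noteq> w y \<and> adj (w x) (w y) = b"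
      using word \<open>x \<noteq> y\<close> \<open>adj x y = b\<close> unfolding preserves_def by blast
    ultimately show "g x \<noteq> g y \<and> adj (g x) (g y) = b" by simp
  qed
qed

lemma generated_inj:
  assumes "inj f" "generates E (unary f) (unary g)"
  shows "inj g"
proof -
  have word: "inj w" if "w \<in> words E f" for w
    using that
  proof induction
    case (words_comp g h)
    then show ?case using inj_compose[of g h] by (simp add: comp_def)
  qed (simp_all add: automorphisms_def bij_def assms(1))
  show ?thesis
  proof (rule injI)
    fix x y assume "g x = g y"
    have "finite {x, y}" by simp
    from generates_unaryD[OF assms(2) this] obtain w where
      "w \<in> words E f" "\<forall>u\<in>{x, y}. g u = w u" by (elim bexE)
    then have "w x = g x" "w y = g y" by simp_all
    then have "w x = w y" using \<open>g x = g y\<close> by simp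
    with word[OF \<open>w \<in> words E f\<close>] show "x = y" by (rule injD)
  qed
qed

lemma adj_pair_exists: "\<exists>x. x \<noteq> z \<and> adj x z = b"
proof -
  obtain v where "v \<notin> {z}" "\<And>u. u \<in> {z} \<Longrightarrow> adj v u = b"
    by (rule extension[of "{z}" "\<lambda>_. b"]) auto
  then show ?thesis by blast
qed

lemma not_preservesI:
  assumes "\<And>x. x \<noteq> z \<Longrightarrow> adj x z = b \<Longrightarrow> adj (f x) (f z) = (\<not> b)"
  shows "\<not> preserves b f"
proof
  assume pres: "preserves b f"
  obtain x where x: "x \<noteq> z" "adj x z = b" using adj_pair_exists by blast
  then have "adj (f x) (f z) = b" using pres unfolding preserves_def by blast
  with assms[OF x] show False by simp
qed

lemma preserves_False_e_N: "is_e_N E e \<Longrightarrow> preserves False e"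
  by (drule is_e_N_imp) (simp add: preserves_def inj_eq)

lemma preserves_True_e_E: "is_e_E E e \<Longrightarrow> preserves True e"
  by (drule is_e_E_imp) (simp add: preserves_def inj_eq)

lemma not_preserves_True_e_N: "is_e_N E e \<Longrightarrow> \<not> preserves True e"
  by (rule not_preservesI[of undefined]) (simp add: is_e_N_imp)

lemma not_preserves_False_e_E: "is_e_E E e \<Longrightarrow> \<not> preserves False e"
  by (rule not_preservesI[of undefined]) (simp add: is_e_E_imp)

lemma not_preserves_minus: "is_minus E m \<Longrightarrow> \<not> preserves b m"
  by (rule not_preservesI[of undefined]) (simp add: is_minus_iff)

lemma not_preserves_switch: "is_switch E z s \<Longrightarrow> \<not> preserves b s"
  by (rule not_preservesI[of z]) (simp add: is_switch_imp_hub hub_def)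

text \<open>
  A word in \<open>-\<close> and automorphisms preserves all pairs or changes all of them, according to the
  parity of the number of occurrences of \<open>-\<close>. The switch changes \<open>{x, z}\<close> but not \<open>{x, y}\<close>.
\<close>

lemma minus_not_generates_switch:
  assumes m: "is_minus E m" and s: "is_switch E z s"
  shows "\<not> generates E (unary m) (unary s)"
proof
  assume gen: "generates E (unary m) (unary s)"
  have word: "\<exists>c. \<forall>x y. x \<noteq> y \<longrightarrow> w x \<noteq> w y \<and> adj (w x) (w y) = (adj x y = c)"
    if "w \<in> words E m" for w
    using that
  proof induction
    case (words_aut a)
    then show ?case by (intro exI[of _ True]) (simp add: automorphisms_def bij_def inj_eq)
  next
    case words_gen
    show ?case using m by (intro exI[of _ False]) (simp add: is_minus_iff bij_def inj_eq)
  next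
    case (words_comp g h)
    obtain c where c: "\<forall>x y. x \<noteq> y \<longrightarrow> g x \<noteq> g y \<and> adj (g x) (g y) = (adj x y = c)"
      using words_comp(3) ..
    obtain d where d: "\<forall>x y. x \<noteq> y \<longrightarrow> h x \<noteq> h y \<and> adj (h x) (h y) = (adj x y = d)"
      using words_comp(4) ..
    have "(g \<circ> h) x \<noteq> (g \<circ> h) y \<and> adj ((g \<circ> h) x) ((g \<circ> h) y) = (adj x y = (c = d))"
      if "x \<noteq> y" for x y
    proof -
      have "h x \<noteq> h y" "adj (h x) (h y) = (adj x y = d)" using d that by blast+
      moreover from this(1) have "g (h x) \<noteq> g (h y)" "adj (g (h x)) (g (h y)) = (adj (h x) (h y) = c)"
        using c by blast+
      ultimately show ?thesis by auto
    qed
    \<comment> \<open>Two complementations cancel: \<open>True\<close> stands for preservation, so parities add as \<open>c = d\<close>.\<close>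
    then show ?case by (intro exI[of _ "c = d"]) simp
  qed
  obtain x where x: "x \<noteq> z" using adj_pair_exists by blast
  obtain y where "y \<notin> {x, z}" by (rule extension[of "{x, z}" "\<lambda>_. True"]) auto
  then have y: "x \<noteq> y" "y \<noteq> z" by auto
  have "finite {x, y, z}" by simp
  from generates_unaryD[OF gen this] obtain w where
    w: "w \<in> words E m" "\<forall>u\<in>{x, y, z}. s u = w u" by (elim bexE)
  obtain c where c: "\<forall>x y. x \<noteq> y \<longrightarrow> w x \<noteq> w y \<and> adj (w x) (w y) = (adj x y = c)"
    using word[OF w(1)] ..
  have "adj (w x) (w z) = (\<not> adj x z)" "adj (w x) (w y) = adj x y"
    using is_switch_imp_hub[OF s, of x z] is_switch_imp_hub[OF s, of x y] x y w(2)
    by (auto simp: hub_def)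
  moreover have "adj (w x) (w z) = (adj x z = c)" "adj (w x) (w y) = (adj x y = c)"
    using c x y by blast+
  ultimately show False by blast
qed

end

lemma exactly_one_nth5:
  assumes "P0 \<or> P1 \<or> P2 \<or> P3 \<or> P4"
    and "\<not> (P0 \<and> P1)" "\<not> (P0 \<and> P2)" "\<not> (P0 \<and> P3)" "\<not> (P0 \<and> P4)" "\<not> (P1 \<and> P2)"
      "\<not> (P1 \<and> P3)" "\<not> (P1 \<and> P4)" "\<not> (P2 \<and> P3)" "\<not> (P2 \<and> P4)" "\<not> (P3 \<and> P4)"
  shows "\<exists>!i. i < 5 \<and> [P0, P1, P2, P3, P4] ! i"
proof -
  have "i < 5 \<and> [P0, P1, P2, P3, P4] ! i \<longleftrightarrow>
      i = 0 \<and> P0 \<or> i = 1 \<and> P1 \<or> i = 2 \<and> P2 \<or> i = 3 \<and> P3 \<or> i = 4 \<and> P4" for i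
    by (auto simp: less_Suc_eq numeral_eq_Suc)
  then show ?thesis using assms by (simp only:) (elim disjE; auto)
qed

theorem theorem3:
  fixes E :: "('v \<times> 'v) set" and z :: 'v and e_N e_E mns sw f :: "'v \<Rightarrow> 'v"
  assumes "random_graph E"
    and "is_e_N E e_N"
    and "is_e_E E e_E"
    and "is_minus E mns"
    and "is_switch E z sw"
    and "minimal E (unary f)"
  shows "\<exists>!i. i < 5 \<and>
    [\<exists>c. equivalent E (unary f) (unary (\<lambda>_. c)),
     equivalent E (unary f) (unary e_N),
     equivalent E (unary f) (unary e_E),
     equivalent E (unary f) (unary mns),
     equivalent E (unary f) (unary sw)] ! i"
proof -
  interpret rado E by unfold_locales (rule assms(1))
  have inj: "inj e_N" "inj e_E" "inj mns" "inj sw"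
    using assms(2-5) by (auto simp: is_e_N_def is_e_E_def is_minus_def is_switch_def bij_def)
  obtain x where "x \<noteq> z" using adj_pair_exists by blast
  then have const: "\<not> inj (\<lambda>_ :: 'v. c)" for c :: 'v using injD[of "\<lambda>_. c" x z] by auto
  have non_trivial: "\<not> trivial E (unary (\<lambda>_. c))" "\<not> trivial E (unary e_N)"
    "\<not> trivial E (unary e_E)" "\<not> trivial E (unary mns)" "\<not> trivial E (unary sw)" for c
  proof -
    have pres: "preserves b g" if "trivial E (unary g)" for b g
      using that by (simp add: trivial_unary_iff preserves_def inj_eq)
    show "\<not> trivial E (unary (\<lambda>_. c))" using const by (simp add: trivial_unary_iff)
    show "\<not> trivial E (unary e_N)" using pres not_preserves_True_e_N[OF assms(2)] by blast
    show "\<not> trivial E (unary e_E)" using pres not_preserves_False_e_E[OF assms(3)] by blast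
    show "\<not> trivial E (unary mns)" using pres not_preserves_minus[OF assms(4)] by blast
    show "\<not> trivial E (unary sw)" using pres not_preserves_switch[OF assms(5)] by blast
  qed
  have "\<not> trivial E (unary f)"
    and min: "\<And>g. generates E (unary f) (unary g) \<Longrightarrow> \<not> trivial E (unary g) \<Longrightarrow>
      equivalent E (unary f) (unary g)"
    using assms(6) unfolding minimal_def by blast+
  from generates_one_of_five[OF this(1) assms(2-5)]
  have ex: "(\<exists>c. equivalent E (unary f) (unary (\<lambda>_. c))) \<or>
     equivalent E (unary f) (unary e_N) \<or> equivalent E (unary f) (unary e_E) \<or>
     equivalent E (unary f) (unary mns) \<or> equivalent E (unary f) (unary sw)"
    using min[OF _ non_trivial(1)] min[OF _ non_trivial(2)] min[OF _ non_trivial(3)]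
      min[OF _ non_trivial(4)] min[OF _ non_trivial(5)] by fast
  have both: "generates E (unary g) (unary h)"
    if "equivalent E (unary f) (unary g)" "equivalent E (unary f) (unary h)" for g h
    using generates_unary_trans[of E g f h] that unfolding equivalent_def by simp
  have not_const: "\<not> ((\<exists>c. equivalent E (unary f) (unary (\<lambda>_. c))) \<and> equivalent E (unary f) (unary g))"
    if "inj g" for g
  proof
    assume "(\<exists>c. equivalent E (unary f) (unary (\<lambda>_. c))) \<and> equivalent E (unary f) (unary g)"
    then obtain c where "equivalent E (unary f) (unary g)" "equivalent E (unary f) (unary (\<lambda>_. c))"
      by blast
    from generated_inj[OF that both[OF this]] const show False by simp
  qed
  have separated: "\<not> (equivalent E (unary f) (unary g) \<and> equivalent E (unary f) (unary h))"
    if "preserves b g" "\<not> preserves b h" for b g h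
    using both[of g h] generated_preserves[OF that(1), of h] that(2) by blast
  note e_N = separated[OF preserves_False_e_N[OF assms(2)]]
  note e_E = separated[OF preserves_True_e_E[OF assms(3)]]
  show ?thesis
  proof (rule exactly_one_nth5[OF ex])
    show "\<not> (equivalent E (unary f) (unary mns) \<and> equivalent E (unary f) (unary sw))"
      using both minus_not_generates_switch[OF assms(4,5)] by blast
  qed (rule not_const[OF inj(1)] not_const[OF inj(2)] not_const[OF inj(3)] not_const[OF inj(4)]
      e_N[OF not_preserves_False_e_E[OF assms(3)]] e_N[OF not_preserves_minus[OF assms(4)]]
      e_N[OF not_preserves_switch[OF assms(5)]] e_E[OF not_preserves_minus[OF assms(4)]]
      e_E[OF not_preserves_switch[OF assms(5)]])+
qed

end
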